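(* Let $\mathfrak h$ be the 3-dimensional Heisenberg Lie algebra over a field $\mathbb K$ of characteristic zero, and let $H_E^{\bullet,\bullet}(\mathfrak h)=\bigoplus_{p+q\text{ even}}H^p(\mathfrak h,\bigwedge^q\mathfrak h)$ with its decomposition into the ten irreducible $\mathrm{SL}(2,\mathbb K)$-submodules $H_k^{p,q}$ and the $\mathrm{SL}(2,\mathbb K)$-isomorphisms $\tau_k^{p,q}:V_k\to H_k^{p,q}$ described in the context. Then the $\mathrm{SL}(2,\mathbb K)$-table of the cup product $\vee$ on $H_E^{\bullet,\bullet}(\mathfrak h)$ is $$\begin{array}{c||ccccc|ccccc} \vee & H_{0}^{0,0} & H_{0}^{1,1} & H_{2}^{1,1} & H_{1}^{2,0} & H_{1}^{0,2} & H_{0}^{2,2} & H_{2}^{2,2} & H_{1}^{3,1} & H_{1}^{1,3} & H_{0}^{3,3}\\ \hline H_{0}^{0,0} & H_{0}^{0,0} & H_{0}^{1,1} & H_{2}^{1,1} & H_{1}^{2,0} & H_{1}^{0,2} & H_{0}^{2,2} & H_{2}^{2,2} & H_{1}^{3,1} & H_{1}^{1,3} & H_{0}^{3,3}\\ H_{0}^{1,1} & H_{0}^{1,1} & -6H_{0}^{2,2} & -2H_{2}^{2,2} & H_{1}^{3,1} & -H_{1}^{1,3} & 2H_{0}^{3,3} & 0&0&0&0\\ H_{2}^{1,1} & H_{2}^{1,1} & -2H_{2}^{2,2} & H_{0}^{2,2} & H_{1}^{3,1} & H_{1}^{1,3} & 0 & -H_{0}^{3,3}&0&0&0\\ H_{1}^{2,0}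 & H_{1}^{2,0} & H_{1}^{3,1} & H_{1}^{3,1} & 0 & \frac12H_{0}^{2,2}-\frac12H_{2}^{2,2} & 0&0&0 & -H_{0}^{3,3}&0\\ H_{1}^{0,2} & H_{1}^{0,2} & -H_{1}^{1,3} & H_{1}^{1,3} & -\frac12H_{0}^{2,2}-\frac12H_{2}^{2,2} & 0&0&0 & -H_{0}^{3,3}&0&0\\ H_{0}^{2,2} & H_{0}^{2,2} & 2H_{0}^{3,3} &0&0&0&0&0&0&0&0\\ H_{2}^{2,2} & H_{2}^{2,2} & 0 & -H_{0}^{3,3} &0&0&0&0&0&0&0\\ H_{1}^{3,1} & H_{1}^{3,1} &0&0&0 & H_{0}^{3,3}&0&0&0&0&0\\ H_{1}^{1,3} & H_{1}^{1,3} &0&0& H_{0}^{3,3}&0&0&0&0&0&0\\ H_{0}^{3,3} & H_{0}^{3,3} &0&0&0&0&0&0&0&0&0 \end{array}$$ This means: if the entry in row $H_{a}^{p_1,q_1}$ and column $H_{b}^{p_2,q_2}$ is $\sum_{k} c_k\,H_{k}^{p,q}$, with $(p,q)=(p_1+p_2,q_1+q_2)$, then for all $v\in V_a$, $w\in V_b$, $$\tau_a^{p_1,q_1}(v)\vee\tau_b^{p_2,q_2}(w)=\sum_k c_k\,\tau_k^{p,q}\big(m^{a,b,k}(v\otimes w)\big),$$ and the product is zero if the entry is $0$.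
   Context: $\mathfrak h$ has basis $x_1,x_{-1},h_0$ with only nonzero bracket $[x_1,x_{-1}]=h_0$ (up to skew-symmetry). The dual basis of $\mathfrak h^*$ is $x^{-1},x^{1},h^0$, with $x^{-1}(x_1)=1$, $x^{1}(x_{-1})=1$, $h^0(h_0)=1$ and all other pairings zero. $\mathrm{SL}(2,\mathbb K)$ acts on $\mathfrak h$ by automorphisms: $h_0$ is fixed and $\mathrm{span}\{x_1,x_{-1}\}$ is the canonical representation ($x_1\leftrightarrow(1,0)$, $x_{-1}\leftrightarrow(0,1)$). If $F$ is the lowering element of the standard basis $\{E,H,F\}$ of $\mathfrak{sl}(2,\mathbb K)$, then $F.x_1=x_{-1}$, $F.x^1=-x^{-1}$. Let $C^{p,q}=\bigwedge^p\mathfrak h^*\otimes\bigwedge^q\mathfrak h$, with product $(\phi\otimes v)\vee(\psi\otimes w)=(-1)^{p_2q_1}\,\phi\wedge\psi\otimes v\wedge w$ for $\phi\otimes v\in C^{p_1,q_1}$, $\psi\otimes w\in C^{p_2,q_2}$. $C^{\bullet,\bullet}$ is a Poisson superalgebra (parity of $C^{p,q}$ is $p+q$) with super-bracket $\{-,-\}:C^{p_1,q_1}\times C^{p_2,q_2}\to C^{p_1+p_2-1,q_1+q_2-1}$ determined by: $\{\mathfrak h,\mathfrak h\}=\{\mathfrak h^*,\mathfrak h^*\}=0$; $\{\phi,v\}=\{v,\phi\}=\phi(v)$ for $\phi\in\mathfrak h^*$, $v\in\mathfrak h$; $\{a,b\}=-(-1)^{(p_1+q_1)(p_2+q_2)}\{b,a\}$;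 and $\{a\vee b,c\}=a\vee\{b,c\}+(-1)^{(p_1+q_1)(p_2+q_2)}b\vee\{a,c\}$, for $a\in C^{p_1,q_1}$, $b\in C^{p_2,q_2}$. Let $\mu=x^{-1}\wedge x^1\otimes h_0\in C^{2,1}$ be the Lie bracket of $\mathfrak h$; the Chevalley–Eilenberg differential is $d=\{\mu,-\}:C^{p,q}\to C^{p+1,q}$, and $H^{p,q}=H^p(\mathfrak h,\bigwedge^q\mathfrak h)$ is its cohomology. The product $\vee$ and the bracket descend to cohomology; the even part $H_E^{\bullet,\bullet}(\mathfrak h)=\bigoplus_{p+q\text{ even}}H^{p,q}$ is a Poisson algebra and $\vee$ on it is the cup product. Irreducible $\mathrm{SL}(2,\mathbb K)$-modules used: $V_0=\mathbb K$ (trivial), $V_1=\mathbb K^2$ (canonical), $V_2=\mathfrak{sl}(2,\mathbb K)$ (adjoint), with highest weight vectors $\bar v$ equal to $1$, $(1,0)$, $\left(\begin{smallmatrix}0&1\\0&0\end{smallmatrix}\right)$ respectively. Chosen equivariant maps $m^{i,j,k}:V_i\otimes V_j\to V_k$: $m^{0,i,i}(c\otimes v)=m^{i,0,i}(v\otimes c)=cv$; $m^{1,1,0}((x_1,x_2)\otimes(y_1,y_2))=x_1y_2-x_2y_1$; $m^{1,1,2}((x_1,x_2)\otimes(y_1,y_2))=\left(\begin{smallmatrix}x_1y_2+x_2y_1&-2x_1y_1\\2x_2y_2&-x_1y_2-x_2y_1\end{smallmatrix}\right)$; $m^{2,1,1}(A\otimes(x_1,x_2))=m^{1,2,1}((x_1,x_2)\otimes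 A)=(x_1,x_2)A^t$; $m^{2,2,0}(A\otimes B)=\mathrm{tr}(AB)$; $m^{2,2,2}(A\otimes B)=AB-BA$. $H_E^{\bullet,\bullet}(\mathfrak h)$ is the direct sum of irreducible submodules $H_k^{p,q}\subset H^{p,q}$, $H_k^{p,q}\simeq V_k$, generated by the classes of the following highest weight vectors (wedge symbols omitted): $H_0^{0,0}$: $1\otimes1$; $H_1^{2,0}$: $x^1h^0\otimes1$; $H_0^{1,1}$: $x^1\otimes x_{-1}+x^{-1}\otimes x_1+2h^0\otimes h_0$; $H_2^{1,1}$: $x^1\otimes x_1$; $H_1^{3,1}$: $x^{-1}x^1h^0\otimes x_1$; $H_1^{0,2}$: $1\otimes x_1h_0$; $H_0^{2,2}$: $x^{-1}x^1\otimes x_1x_{-1}$; $H_2^{2,2}$: $x^1h^0\otimes x_1h_0$; $H_1^{1,3}$: $x^1\otimes x_1x_{-1}h_0$; $H_0^{3,3}$: $x^{-1}x^1h^0\otimes x_1x_{-1}h_0$. The map $\tau_k^{p,q}:V_k\to H_k^{p,q}$ is the unique $\mathrm{SL}(2,\mathbb K)$-isomorphism sending the chosen highest weight vector $\bar v\in V_k$ to the class of the listed highest weight vector. *)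

theory Defs
  imports "HOL-Analysis.Determinants" "HOL-Library.FuncSet"
begin

section \<open>The Heisenberg Lie algebra\<close>

text \<open>
  The indices \<open>I1\<close>, \<open>Im1\<close>, \<open>I0\<close> number the basis \<open>x_1\<close>, \<open>x_{-1}\<close>, \<open>h_0\<close> of the Lie algebra and,
  in the same order, the dual basis \<open>x^{-1}\<close>, \<open>x^1\<close>, \<open>h^0\<close>. Note that the covector dual to \<open>x_1\<close>
  is called \<open>x^{-1}\<close> and the covector dual to \<open>x_{-1}\<close> is called \<open>x^1\<close> (upper indices are weights).
\<close>

datatype hidx = I1 | Im1 | I0

instance hidx :: finite
proof
  have "(UNIV :: hidx set) \<subseteq> {I1, Im1, I0}"
    using hidx.exhaust by blast
  then show "finite (UNIV :: hidx set)"
    by (rule finite_subset) simp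
qed

primrec hidx_rank :: "hidx \<Rightarrow> nat" where
  "hidx_rank I1 = 0"
| "hidx_rank Im1 = 1"
| "hidx_rank I0 = 2"

instantiation hidx :: linorder
begin

definition "i \<le> j \<longleftrightarrow> hidx_rank i \<le> hidx_rank j"
definition "i < j \<longleftrightarrow> hidx_rank i < hidx_rank j"

instance
proof
  fix i j :: hidx
  assume "i \<le> j" "j \<le> i"
  then show "i = j"
    by (cases i; cases j) (auto simp: less_eq_hidx_def)
qed (auto simp: less_eq_hidx_def less_hidx_def)

end

type_synonym 'a heis = "'a ^ hidx"
type_synonym 'a heis_dual = "'a ^ hidx"

definition heis_bracket :: "'a::field heis \<Rightarrow> 'a heis \<Rightarrow> 'a heis" where
  "heis_bracket v w = (v$I1 * w$Im1 - v$Im1 * w$I1) *s axis I0 1"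

definition pairing :: "'a::field heis_dual \<Rightarrow> 'a heis \<Rightarrow> 'a" where
  "pairing \<phi> v = (\<Sum>i\<in>UNIV. \<phi>$i * v$i)"


section \<open>Exterior algebras and the algebra of cochains\<close>

text \<open>
  An element of the exterior algebra on a space with basis \<open>e i\<close> (\<open>i :: hidx\<close>) is given by its
  coordinates in the basis of the increasing monomials \<open>e S = e i1 \<and> \<dots> \<and> e ir\<close>,
  \<open>S = {i1 < \<dots> < ir}\<close>.
\<close>

type_synonym 'a ext = "'a ^ (hidx set)"

definition inversions :: "hidx set \<Rightarrow> hidx set \<Rightarrow> nat" where
  "inversions S T = card {(s, t). s \<in> S \<and> t \<in> T \<and> t < s}"

definition wedge_basis :: "hidx set \<Rightarrow> hidx set \<Rightarrow> 'a::field ext" where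
  "wedge_basis S T = (if S \<inter> T = {} then (-1) ^ inversions S T *s axis (S \<union> T) 1 else 0)"

definition wedge :: "'a::field ext \<Rightarrow> 'a ext \<Rightarrow> 'a ext"  (infixr "\<and>\<^sub>e" 70) where
  "x \<and>\<^sub>e y = (\<Sum>S\<in>UNIV. \<Sum>T\<in>UNIV. (x$S * y$T) *s wedge_basis S T)"

definition ext_one :: "'a::field ext" where
  "ext_one = axis {} 1"

definition ext_vec :: "'a::field ^ hidx \<Rightarrow> 'a ext" where
  "ext_vec v = (\<Sum>i\<in>UNIV. v$i *s axis {i} 1)"

text \<open>The image of the basis monomial \<open>e S\<close> under the algebra endomorphism extending a linear map.\<close>

definition ext_map_basis :: "('a::field ^ hidx \<Rightarrow> 'a ^ hidx) \<Rightarrow> hidx set \<Rightarrow> 'a ext" where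
  "ext_map_basis L S =
     foldr (\<lambda>i y. ext_vec (L (axis i 1)) \<and>\<^sub>e y) (sorted_list_of_set S) ext_one"

text \<open>
  Cochains: the component at \<open>(S, T)\<close> is the coefficient of \<open>e^S \<otimes> e_T\<close>, where \<open>S\<close> indexes
  a monomial in the dual space and \<open>T\<close> one in the Lie algebra itself.
\<close>

type_synonym 'a cochain = "'a ^ (hidx set \<times> hidx set)"

definition tens :: "'a::field ext \<Rightarrow> 'a ext \<Rightarrow> 'a cochain"  (infix "\<otimes>\<^sub>e" 68) where
  "\<phi> \<otimes>\<^sub>e v = (\<chi> ST. \<phi> $ fst ST * v $ snd ST)"

definition Cpq :: "nat \<Rightarrow> nat \<Rightarrow> 'a::field cochain set" where
  "Cpq p q = {a. \<forall>S T. a$(S, T) \<noteq> 0 \<longrightarrow> card S = p \<and> card T = q}"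

definition vee :: "'a::field cochain \<Rightarrow> 'a cochain \<Rightarrow> 'a cochain"  (infixl "\<or>\<^sub>C" 65) where
  "a \<or>\<^sub>C b = (\<Sum>(S1, T1)\<in>UNIV. \<Sum>(S2, T2)\<in>UNIV.
     (a$(S1, T1) * b$(S2, T2) * (-1) ^ (card S2 * card T1)) *s
       (wedge_basis S1 S2 \<otimes>\<^sub>e wedge_basis T1 T2))"

definition of_heis :: "'a::field heis \<Rightarrow> 'a cochain" where
  "of_heis v = ext_one \<otimes>\<^sub>e ext_vec v"

definition of_heis_dual :: "'a::field heis_dual \<Rightarrow> 'a cochain" where
  "of_heis_dual \<phi> = ext_vec \<phi> \<otimes>\<^sub>e ext_one"


section \<open>Poisson bracket and differential\<close>

text \<open>Spaces \<open>C^{p,q}\<close> with a negative index are zero, whence the case distinction for bidegrees.\<close>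

definition is_poisson_bracket :: "('a::field cochain \<Rightarrow> 'a cochain \<Rightarrow> 'a cochain) \<Rightarrow> bool" where
  "is_poisson_bracket B \<longleftrightarrow>
     (\<forall>a. Vector_Spaces.linear (*s) (*s) (B a)) \<and>
     (\<forall>b. Vector_Spaces.linear (*s) (*s) (\<lambda>a. B a b)) \<and>
     (\<forall>p1 q1 p2 q2. \<forall>a\<in>Cpq p1 q1. \<forall>b\<in>Cpq p2 q2.
        if p1 + p2 = 0 \<or> q1 + q2 = 0 then B a b = 0
        else B a b \<in> Cpq (p1 + p2 - 1) (q1 + q2 - 1)) \<and>
     (\<forall>v w. B (of_heis v) (of_heis w) = 0) \<and>
     (\<forall>\<phi> \<psi>. B (of_heis_dual \<phi>) (of_heis_dual \<psi>) = 0) \<and>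
     (\<forall>\<phi> v. B (of_heis_dual \<phi>) (of_heis v) = pairing \<phi> v *s (ext_one \<otimes>\<^sub>e ext_one)) \<and>
     (\<forall>\<phi> v. B (of_heis v) (of_heis_dual \<phi>) = pairing \<phi> v *s (ext_one \<otimes>\<^sub>e ext_one)) \<and>
     (\<forall>p1 q1 p2 q2. \<forall>a\<in>Cpq p1 q1. \<forall>b\<in>Cpq p2 q2.
        B a b = - ((-1) ^ ((p1 + q1) * (p2 + q2)) *s B b a)) \<and>
     (\<forall>p1 q1 p2 q2. \<forall>a\<in>Cpq p1 q1. \<forall>b\<in>Cpq p2 q2. \<forall>c.
        B (a \<or>\<^sub>C b) c = (a \<or>\<^sub>C B b c) + (-1) ^ ((p1 + q1) * (p2 + q2)) *s (b \<or>\<^sub>C B a c))"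

definition poisson :: "'a::field cochain \<Rightarrow> 'a cochain \<Rightarrow> 'a cochain" where
  "poisson = (THE B. is_poisson_bracket B)"

abbreviation xd1 :: "'a::field ext" where "xd1 \<equiv> axis {I1} 1"      \<comment> \<open>\<open>x_1\<close>\<close>
abbreviation xdm1 :: "'a::field ext" where "xdm1 \<equiv> axis {Im1} 1"   \<comment> \<open>\<open>x_{-1}\<close>\<close>
abbreviation hd0 :: "'a::field ext" where "hd0 \<equiv> axis {I0} 1"      \<comment> \<open>\<open>h_0\<close>\<close>
abbreviation xum1 :: "'a::field ext" where "xum1 \<equiv> axis {I1} 1"    \<comment> \<open>\<open>x^{-1}\<close>, dual to \<open>x_1\<close>\<close>
abbreviation xu1 :: "'a::field ext" where "xu1 \<equiv> axis {Im1} 1"     \<comment> \<open>\<open>x^1\<close>, dual to \<open>x_{-1}\<close>\<close>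
abbreviation hu0 :: "'a::field ext" where "hu0 \<equiv> axis {I0} 1"      \<comment> \<open>\<open>h^0\<close>, dual to \<open>h_0\<close>\<close>

definition mu :: "'a::field cochain" where
  "mu = (xum1 \<and>\<^sub>e xu1) \<otimes>\<^sub>e hd0"

lemma mu_heis_bracket:
  "mu = (\<Sum>(i, j)\<in>{(i, j). i < j}.
     (ext_vec (axis i 1) \<and>\<^sub>e ext_vec (axis j 1)) \<otimes>\<^sub>e
       ext_vec (heis_bracket (axis i 1) (axis j 1 :: 'a::field heis)))"
proof -
  have "(i, j) \<in> {(i, j). i < j} \<longleftrightarrow> (i, j) \<in> {(I1, Im1), (I1, I0), (Im1, I0)}" for i j
    by (cases i; cases j) (simp_all add: less_hidx_def)
  then have *: "{(i, j). i < j} = {(I1, Im1), (I1, I0), (Im1, I0)}"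
    by (metis (no_types, lifting) subrelI subset_antisym)
  have ext_vec_axis: "ext_vec (axis i 1) = (axis {i} 1 :: 'a ext)" for i
  proof -
    have "ext_vec (axis i 1) = (\<Sum>k\<in>UNIV. if k = i then axis {i} 1 else (0 :: 'a ext))"
      unfolding ext_vec_def by (rule sum.cong) (auto simp: axis_def)
    then show ?thesis by simp
  qed
  have "heis_bracket (axis I1 1) (axis Im1 1) = (axis I0 1 :: 'a heis)"
       "heis_bracket (axis I1 1) (axis I0 1) = (0 :: 'a heis)"
       "heis_bracket (axis Im1 1) (axis I0 1) = (0 :: 'a heis)"
    by (simp_all add: heis_bracket_def) (simp_all add: axis_def)
  moreover have "ext_vec (0 :: 'a heis) = 0" "x \<otimes>\<^sub>e 0 = (0 :: 'a cochain)" for x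
    by (simp_all add: ext_vec_def tens_def vec_eq_iff)
  ultimately show ?thesis
    unfolding * by (simp add: mu_def ext_vec_axis)
qed

definition ce_d :: "'a::field cochain \<Rightarrow> 'a cochain" where
  "ce_d a = poisson mu a"


section \<open>Cohomology\<close>

text \<open>
  The total cohomology is the quotient of the cocycles by the coboundaries; the space \<open>H^{p,q}\<close> is
  its subspace of classes of cocycles in \<open>C^{p,q}\<close>, and \<open>H_E\<close> the sum of those with \<open>p + q\<close> even.
  Operations on classes are induced by the operations on representatives.
\<close>

definition cocycles :: "'a::field cochain set" where
  "cocycles = {a. ce_d a = 0}"

definition coh_rel :: "('a::field cochain \<times> 'a cochain) set" where
  "coh_rel = {(a, b). a \<in> cocycles \<and> b \<in> cocycles \<and> a - b \<in> range ce_d}"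

abbreviation coh_class :: "'a::field cochain \<Rightarrow> 'a cochain set" where
  "coh_class a \<equiv> coh_rel `` {a}"

definition H_E :: "'a::field cochain set set" where
  "H_E = {a \<in> cocycles. \<forall>S T. a$(S, T) \<noteq> 0 \<longrightarrow> even (card S + card T)} // coh_rel"

definition coh_add :: "'a::field cochain set \<Rightarrow> 'a cochain set \<Rightarrow> 'a cochain set" where
  "coh_add X Y = (\<Union>x\<in>X. \<Union>y\<in>Y. coh_class (x + y))"

definition coh_scale :: "'a::field \<Rightarrow> 'a cochain set \<Rightarrow> 'a cochain set" where
  "coh_scale c X = (\<Union>x\<in>X. coh_class (c *s x))"

definition cup :: "'a::field cochain set \<Rightarrow> 'a cochain set \<Rightarrow> 'a cochain set" where
  "cup X Y = (\<Union>x\<in>X. \<Union>y\<in>Y. coh_class (x \<or>\<^sub>C y))"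

definition coh_sum_list :: "'a::field cochain set list \<Rightarrow> 'a cochain set" where
  "coh_sum_list Xs = foldr coh_add Xs (coh_class 0)"


section \<open>The action of SL(2)\<close>

definition SL2 :: "('a::field ^ 2 ^ 2) set" where
  "SL2 = {g. det g = 1}"

definition heis_act :: "'a::field ^ 2 ^ 2 \<Rightarrow> 'a heis \<Rightarrow> 'a heis" where
  "heis_act g v = (\<chi> i. case i of
       I1 \<Rightarrow> g$1$1 * v$I1 + g$1$2 * v$Im1
     | Im1 \<Rightarrow> g$2$1 * v$I1 + g$2$2 * v$Im1
     | I0 \<Rightarrow> v$I0)"

text \<open>The contragredient action \<open>(g.\<phi>)(v) = \<phi>(g^{-1}.v)\<close>.\<close>

definition heis_dual_act :: "'a::field ^ 2 ^ 2 \<Rightarrow> 'a heis_dual \<Rightarrow> 'a heis_dual" where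
  "heis_dual_act g \<phi> = (\<chi> j. pairing \<phi> (heis_act (matrix_inv g) (axis j 1)))"

definition cochain_act :: "'a::field ^ 2 ^ 2 \<Rightarrow> 'a cochain \<Rightarrow> 'a cochain" where
  "cochain_act g a = (\<Sum>(S, T)\<in>UNIV.
     a$(S, T) *s (ext_map_basis (heis_dual_act g) S \<otimes>\<^sub>e ext_map_basis (heis_act g) T))"

definition coh_act :: "'a::field ^ 2 ^ 2 \<Rightarrow> 'a cochain set \<Rightarrow> 'a cochain set" where
  "coh_act g X = (\<Union>x\<in>X. coh_class (cochain_act g x))"

definition is_submodule :: "'a::field cochain set set \<Rightarrow> bool" where
  "is_submodule W \<longleftrightarrow> W \<subseteq> H_E \<and> coh_class 0 \<in> W \<and>
     (\<forall>X\<in>W. \<forall>Y\<in>W. coh_add X Y \<in> W) \<and>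
     (\<forall>c. \<forall>X\<in>W. coh_scale c X \<in> W) \<and>
     (\<forall>g\<in>SL2. \<forall>X\<in>W. coh_act g X \<in> W)"


section \<open>The irreducible modules\<close>

text \<open>
  To index \<open>V_0 = K\<close>, \<open>V_1 = K^2\<close>, \<open>V_2 = sl(2,K)\<close> by a number, they are taken as the three summands
  of \<open>K \<oplus> K^2 \<oplus> gl(2,K)\<close> (for \<open>V_2\<close>: the trace zero part of the last one).
\<close>

type_synonym 'a irr = "'a \<times> ('a ^ 2) \<times> ('a ^ 2 ^ 2)"

definition V :: "nat \<Rightarrow> 'a::field irr set" where
  "V k = (if k = 0 then {(c, 0, 0) |c. True}
          else if k = 1 then {(0, x, 0) |x. True}
          else if k = 2 then {(0, 0, A) |A. trace A = 0}
          else {})"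

definition vbar :: "nat \<Rightarrow> 'a::field irr" where
  "vbar k = (if k = 0 then (1, 0, 0)
             else if k = 1 then (0, vector [1, 0], 0)
             else (0, 0, vector [vector [0, 1], vector [0, 0]]))"

definition irr_scale :: "'a::field \<Rightarrow> 'a irr \<Rightarrow> 'a irr" where
  "irr_scale r = (\<lambda>(c, x, A). (r * c, r *s x, \<chi> i. r *s A$i))"

definition irr_act :: "'a::field ^ 2 ^ 2 \<Rightarrow> 'a irr \<Rightarrow> 'a irr" where
  "irr_act g = (\<lambda>(c, x, A). (c, g *v x, g ** A ** matrix_inv g))"

text \<open>The bilinear maps \<open>m^{i,j,k}\<close>; the value for all other triples \<open>i\<close>, \<open>j\<close>, \<open>k\<close> is irrelevant.\<close>

definition m_map :: "nat \<Rightarrow> nat \<Rightarrow> nat \<Rightarrow> 'a::field irr \<Rightarrow> 'a irr \<Rightarrow> 'a irr" where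
  "m_map i j k v w = (case v of (c, x, A) \<Rightarrow> case w of (r, y, B) \<Rightarrow>
     if i = 0 \<and> j = k then irr_scale c w
     else if j = 0 \<and> i = k then irr_scale r v
     else if (i, j, k) = (1, 1, 0) then (x$1 * y$2 - x$2 * y$1, 0, 0)
     else if (i, j, k) = (1, 1, 2) then
       (0, 0, vector [vector [x$1 * y$2 + x$2 * y$1, - 2 * x$1 * y$1],
                      vector [2 * x$2 * y$2, - x$1 * y$2 - x$2 * y$1]])
     else if (i, j, k) = (2, 1, 1) then (0, y v* transpose A, 0)
     else if (i, j, k) = (1, 2, 1) then (0, x v* transpose B, 0)
     else if (i, j, k) = (2, 2, 0) then (trace (A ** B), 0, 0)
     else if (i, j, k) = (2, 2, 2) then (0, 0, A ** B - B ** A)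
     else 0)"


section \<open>The irreducible submodules of the even cohomology and the table\<close>

text \<open>\<open>Hk_pq\<close> is the label of the submodule \<open>H_k^{p,q}\<close>.\<close>

datatype summand =
    H0_00 | H0_11 | H2_11 | H1_20 | H1_02 | H0_22 | H2_22 | H1_31 | H1_13 | H0_33

primrec hw :: "summand \<Rightarrow> nat" where
  "hw H0_00 = 0"
| "hw H0_11 = 0"
| "hw H2_11 = 2"
| "hw H1_20 = 1"
| "hw H1_02 = 1"
| "hw H0_22 = 0"
| "hw H2_22 = 2"
| "hw H1_31 = 1"
| "hw H1_13 = 1"
| "hw H0_33 = 0"

primrec hwv :: "summand \<Rightarrow> 'a::field cochain" where
  "hwv H0_00 = ext_one \<otimes>\<^sub>e ext_one"
| "hwv H0_11 = (xu1 \<otimes>\<^sub>e xdm1) + (xum1 \<otimes>\<^sub>e xd1) + 2 *s (hu0 \<otimes>\<^sub>e hd0)"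
| "hwv H2_11 = xu1 \<otimes>\<^sub>e xd1"
| "hwv H1_20 = (xu1 \<and>\<^sub>e hu0) \<otimes>\<^sub>e ext_one"
| "hwv H1_02 = ext_one \<otimes>\<^sub>e (xd1 \<and>\<^sub>e hd0)"
| "hwv H0_22 = (xum1 \<and>\<^sub>e xu1) \<otimes>\<^sub>e (xd1 \<and>\<^sub>e xdm1)"
| "hwv H2_22 = (xu1 \<and>\<^sub>e hu0) \<otimes>\<^sub>e (xd1 \<and>\<^sub>e hd0)"
| "hwv H1_31 = (xum1 \<and>\<^sub>e xu1 \<and>\<^sub>e hu0) \<otimes>\<^sub>e xd1"
| "hwv H1_13 = xu1 \<otimes>\<^sub>e (xd1 \<and>\<^sub>e xdm1 \<and>\<^sub>e hd0)"
| "hwv H0_33 = (xum1 \<and>\<^sub>e xu1 \<and>\<^sub>e hu0) \<otimes>\<^sub>e (xd1 \<and>\<^sub>e xdm1 \<and>\<^sub>e hd0)"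

definition H_sub :: "summand \<Rightarrow> 'a::field cochain set set" where
  "H_sub s = is_submodule hull {coh_class (hwv s)}"

text \<open>Functions on \<open>V_k\<close> are normalised outside \<open>V_k\<close> by \<open>extensional\<close>, so that they can be unique.\<close>

definition is_tau :: "summand \<Rightarrow> ('a::field irr \<Rightarrow> 'a cochain set) \<Rightarrow> bool" where
  "is_tau s f \<longleftrightarrow> f \<in> extensional (V (hw s)) \<and> bij_betw f (V (hw s)) (H_sub s) \<and>
     (\<forall>v\<in>V (hw s). \<forall>w\<in>V (hw s). f (v + w) = coh_add (f v) (f w)) \<and>
     (\<forall>c. \<forall>v\<in>V (hw s). f (irr_scale c v) = coh_scale c (f v)) \<and>
     (\<forall>g\<in>SL2. \<forall>v\<in>V (hw s). f (irr_act g v) = coh_act g (f v)) \<and>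
     f (vbar (hw s)) = coh_class (hwv s)"

definition tau :: "summand \<Rightarrow> 'a::field irr \<Rightarrow> 'a cochain set" where
  "tau s = (THE f. is_tau s f)"

definition header :: "summand list" where
  "header = [H0_00, H0_11, H2_11, H1_20, H1_02, H0_22, H2_22, H1_31, H1_13, H0_33]"

text \<open>
  Rows and columns of the table follow \<open>header\<close>. An entry is the list of its summands
  \<open>(c_k, H_k^{p,q})\<close>; the empty list is the entry \<open>0\<close>.
\<close>

definition cup_table :: "('a::field \<times> summand) list list list" where
  "cup_table =
    [[[(1, H0_00)], [(1, H0_11)], [(1, H2_11)], [(1, H1_20)], [(1, H1_02)],
      [(1, H0_22)], [(1, H2_22)], [(1, H1_31)], [(1, H1_13)], [(1, H0_33)]],
     [[(1, H0_11)], [(-6, H0_22)], [(-2, H2_22)], [(1, H1_31)], [(-1, H1_13)],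
      [(2, H0_33)], [], [], [], []],
     [[(1, H2_11)], [(-2, H2_22)], [(1, H0_22)], [(1, H1_31)], [(1, H1_13)],
      [], [(-1, H0_33)], [], [], []],
     [[(1, H1_20)], [(1, H1_31)], [(1, H1_31)], [], [(1/2, H0_22), (-1/2, H2_22)],
      [], [], [], [(-1, H0_33)], []],
     [[(1, H1_02)], [(-1, H1_13)], [(1, H1_13)], [(-1/2, H0_22), (-1/2, H2_22)], [],
      [], [], [(-1, H0_33)], [], []],
     [[(1, H0_22)], [(2, H0_33)], [], [], [],
      [], [], [], [], []],
     [[(1, H2_22)], [], [(-1, H0_33)], [], [],
      [], [], [], [], []],
     [[(1, H1_31)], [], [], [], [(1, H0_33)],
      [], [], [], [], []],
     [[(1, H1_13)], [], [], [(1, H0_33)], [],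
      [], [], [], [], []],
     [[(1, H0_33)], [], [], [], [],
      [], [], [], [], []]]"

end

theory Submission
  imports Defs
begin

text \<open>
  All ten summands of the even cohomology have equivariant representatives on the level of cochains:
  since the listed highest weight vectors are highest weight vectors already in the space of
  cochains, the map \<open>V k \<rightarrow> H\<close> lifts to a linear map \<^term>\<open>lift s\<close> into cocycles which is
  \<open>SL(2)\<close>-equivariant on the nose (\<open>lift_equivariant\<close>). The cup product of two classes is the class
  of the product of two lifts, and that product is, for each of the hundred pairs, the combination
  of lifts that the table predicts plus a coboundary (\<open>lift_vee_lift\<close>). The coboundary can only be
  nonzero where the invariants of \<open>C\<^sup>2\<^sup>,\<^sup>2\<close> enter: they form a plane containing the exact line
  spanned by \<open>d (h\<^sup>0 \<otimes> x\<^sub>1 x\<^sub>-\<^sub>1)\<close>. For three pairs a multiple of this cochain has to be added; in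
  all others the equation holds for cochains.

  The cochains are computed with as words in six anticommuting generators, the basis vectors of
  \<open>h\<^sup>* \<oplus> h\<close>, brought to normal order. The Poisson bracket, which is only characterized axiomatically,
  becomes explicit through contractions: it is the sum over the generators \<open>x\<close> of
  \<open>\<plusminus> (\<partial>\<^sub>x a) \<or> (\<partial>\<^sub>x\<^sub>* b)\<close>, with \<open>x\<^sub>*\<close> dual to \<open>x\<close>; the Leibniz rule and graded commutativity show that
  it satisfies the axioms, and generators together with the Leibniz rule show that nothing else
  does (\<open>poisson_eq_bracket\<close>). Hence the differential is an odd derivation given by its values on
  generators, which makes the cup product well defined and, because \<open>SL(2)\<close> acts by algebra
  automorphisms, reduces equivariance of \<open>d\<close> to the six generators.

  It remains to see that the maps \<open>\<tau>\<close> are the classes of the lifts (\<open>tau_eq\<close>). Each \<open>V k\<close> is spanned by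
  the orbit of its highest weight vector (\<open>V_induct\<close>); this yields both that the image of the lift is
  the submodule generated by the class of the highest weight vector and that an equivariant map is
  determined by one value. Injectivity is a form of Poincare duality (\<open>lift_exact\<close>): if a lift were
  exact, so would be its products with the lifts of the complementary summand, but those products
  form a nondegenerate pairing into the top degree, where no nonzero cochain is exact.
\<close>

section \<open>Cochains as an exterior algebra on six generators\<close>

text \<open>
  The dual basis vectors precede the basis vectors. With this order the sign in the definition of the
  product \<open>\<or>\<^sub>C\<close> becomes the usual sign of a shuffle in one exterior algebra on six generators.
\<close>

primrec gen_rank :: "hidx + hidx \<Rightarrow> nat" where
  "gen_rank (Inl i) = hidx_rank i"
| "gen_rank (Inr i) = 3 + hidx_rank i"

definition inv_number :: "(hidx + hidx) set \<Rightarrow> (hidx + hidx) set \<Rightarrow> nat" where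
  "inv_number A B = card {(s, t). s \<in> A \<and> t \<in> B \<and> gen_rank t < gen_rank s}"

text \<open>
  A set of generators, \<open>Inl i\<close> standing for a dual basis vector and \<open>Inr i\<close> for a basis vector, is split into
  the pair of index sets by which the coordinates of a cochain are numbered.
\<close>

abbreviation bideg_index :: "(hidx + hidx) set \<Rightarrow> hidx set \<times> hidx set" where
  "bideg_index A \<equiv> (Inl -` A, Inr -` A)"

definition monomial :: "(hidx + hidx) set \<Rightarrow> 'a::field cochain" where
  "monomial A = axis (bideg_index A) 1"

abbreviation gen :: "hidx + hidx \<Rightarrow> 'a::field cochain" where
  "gen x \<equiv> monomial {x}"

abbreviation one_C :: "'a::field cochain" where
  "one_C \<equiv> ext_one \<otimes>\<^sub>e ext_one"

lemma finite_gen_set [simp]: "finite (A :: (hidx + hidx) set)"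
  by (rule finite)

lemma hidx_rank_inj: "hidx_rank i = hidx_rank j \<longleftrightarrow> i = j"
  by (cases i; cases j) auto

lemma hidx_rank_less: "hidx_rank i < 3"
  by (cases i) auto

lemma gen_rank_inj: "gen_rank x = gen_rank y \<longleftrightarrow> x = y"
  using hidx_rank_less[of "projl x"] hidx_rank_less[of "projl y"]
  by (cases x; cases y) (auto simp: hidx_rank_inj)

lemma UNIV_hidx: "UNIV = {I1, Im1, I0}"
  by (auto intro: hidx.exhaust)

lemma sum_hidx: "(\<Sum>i\<in>UNIV. f i) = f I1 + f Im1 + f I0" for f :: "hidx \<Rightarrow> 'b::comm_monoid_add"
  by (simp add: UNIV_hidx add.assoc)

lemma sum_gen: "(\<Sum>x\<in>UNIV. f x) = (\<Sum>i\<in>UNIV. f (Inl i)) + (\<Sum>i\<in>UNIV. f (Inr i))"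
  for f :: "hidx + hidx \<Rightarrow> 'b::comm_monoid_add"
  unfolding UNIV_Plus_UNIV[symmetric] Plus_def
  by (subst sum.union_disjoint) (auto simp: sum.reindex)

lemma bideg_index_surj: obtains A where "bideg_index A = ST"
proof
  show "bideg_index (fst ST <+> snd ST) = ST" by (cases ST) auto
qed

lemma bideg_index_inj: "bideg_index A = bideg_index B \<longleftrightarrow> A = B"
proof
  assume "bideg_index A = bideg_index B"
  then have "Inl x \<in> A \<longleftrightarrow> Inl x \<in> B" "Inr x \<in> A \<longleftrightarrow> Inr x \<in> B" for x by auto
  then show "A = B" by (metis (no_types, lifting) set_eqI sum.exhaust)
qed auto

lemma card_bideg_index: "card A = card (Inl -` A) + card (Inr -` A)" for A :: "(hidx + hidx) set"
proof -
  have "A = (Inl -` A) <+> (Inr -` A)"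
    by (rule set_eqI) (case_tac x; auto)
  then show ?thesis by (metis card_Plus finite)
qed

lemma cochain_expand: "a = (\<Sum>A\<in>UNIV. (a $ bideg_index A) *s monomial A)" for a :: "'a::field cochain"
proof (rule vec_eq_iff[THEN iffD2], rule allI)
  fix ST
  obtain B where B: "bideg_index B = ST" by (rule bideg_index_surj)
  have m: "monomial A $ ST = (if B = A then 1 else (0 :: 'a))" for A
    unfolding monomial_def axis_def vec_lambda_beta B[symmetric] bideg_index_inj ..
  have "(\<Sum>A\<in>UNIV. (a $ bideg_index A) *s monomial A) $ ST =
        (\<Sum>A\<in>UNIV. if B = A then a $ bideg_index A else 0)"
    unfolding sum_component by (rule sum.cong) (simp_all add: m)
  then show "a $ ST = (\<Sum>A\<in>UNIV. (a $ bideg_index A) *s monomial A) $ ST"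
    by (simp add: B)
qed

lemma axis_induct [case_names add scale axis]:
  fixes x :: "'a::field ^ 'n"
  assumes add: "\<And>x y. P x \<Longrightarrow> P y \<Longrightarrow> P (x + y)"
    and scale: "\<And>c x. P x \<Longrightarrow> P (c *s x)"
    and axis: "\<And>i. P (axis i 1)"
  shows "P x"
proof -
  have 0: "P 0" using scale[of "axis undefined 1" 0] axis by simp
  have "finite F \<Longrightarrow> P (\<Sum>i\<in>F. x $ i *s axis i 1)" for F
    by (induction F rule: finite_induct) (auto simp: 0 add scale axis)
  then show ?thesis by (subst basis_expansion[symmetric]) simp
qed

lemma cochain_basis_induct [case_names add scale monomial]:
  fixes a :: "'a::field cochain"
  assumes add: "\<And>a b. P a \<Longrightarrow> P b \<Longrightarrow> P (a + b)"
    and scale: "\<And>c a. P a \<Longrightarrow> P (c *s a)"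
    and monomial: "\<And>A. P (monomial A)"
  shows "P a"
proof (rule axis_induct[of P])
  fix ST
  obtain A where "bideg_index A = ST" by (rule bideg_index_surj)
  then show "P (axis ST 1)" using monomial[of A] by (simp add: monomial_def)
qed (use add scale in auto)

lemma tens_simps:
  "0 \<otimes>\<^sub>e v = 0" "\<phi> \<otimes>\<^sub>e 0 = 0"
  "(\<phi> + \<psi>) \<otimes>\<^sub>e v = (\<phi> \<otimes>\<^sub>e v) + (\<psi> \<otimes>\<^sub>e v)" "\<phi> \<otimes>\<^sub>e (v + w) = (\<phi> \<otimes>\<^sub>e v) + (\<phi> \<otimes>\<^sub>e w)"
  "(c *s \<phi>) \<otimes>\<^sub>e v = c *s (\<phi> \<otimes>\<^sub>e v)" "\<phi> \<otimes>\<^sub>e (c *s v) = c *s (\<phi> \<otimes>\<^sub>e v)"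
  by (simp_all add: tens_def vec_eq_iff algebra_simps)

lemma tens_axis: "axis S 1 \<otimes>\<^sub>e axis T 1 = axis (S, T) 1"
  by (auto simp: tens_def vec_eq_iff axis_def)

lemma one_C_monomial: "one_C = monomial {}"
  by (simp add: ext_one_def tens_axis monomial_def)

lemma vee_add_left: "(a + b) \<or>\<^sub>C c = (a \<or>\<^sub>C c) + (b \<or>\<^sub>C c)"
  by (simp add: vee_def split_def distrib_right vec.scale_left_distrib sum.distrib)

lemma vee_add_right: "a \<or>\<^sub>C (b + c) = (a \<or>\<^sub>C b) + (a \<or>\<^sub>C c)"
  by (simp add: vee_def split_def distrib_right distrib_left vec.scale_left_distrib sum.distrib)

lemma vee_scale_left: "(r *s a) \<or>\<^sub>C c = r *s (a \<or>\<^sub>C c)"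
  by (simp add: vee_def split_def vec.scale_sum_right mult.assoc)

lemma vee_scale_right: "a \<or>\<^sub>C (r *s c) = r *s (a \<or>\<^sub>C c)"
  by (simp add: vee_def split_def vec.scale_sum_right mult.assoc mult.left_commute[of _ r])

lemma vee_zero_left: "0 \<or>\<^sub>C c = 0"
  by (simp add: vee_def split_def)

lemma vee_zero_right: "a \<or>\<^sub>C 0 = 0"
  by (simp add: vee_def split_def)

lemma vee_minus_left: "(- a) \<or>\<^sub>C c = - (a \<or>\<^sub>C c)"
  using vee_scale_left[of "- 1" a c] by simp

lemma vee_minus_right: "a \<or>\<^sub>C (- c) = - (a \<or>\<^sub>C c)"
  using vee_scale_right[of a "- 1" c] by simp

lemma vee_diff_left: "(a - b) \<or>\<^sub>C c = (a \<or>\<^sub>C c) - (b \<or>\<^sub>C c)"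
  using vee_add_left[of a "- b" c] by (simp add: vee_minus_left)

lemma vee_diff_right: "a \<or>\<^sub>C (b - c) = (a \<or>\<^sub>C b) - (a \<or>\<^sub>C c)"
  using vee_add_right[of a b "- c"] by (simp add: vee_minus_right)

lemmas vee_linear = vee_add_left vee_add_right vee_scale_left vee_scale_right vee_zero_left
  vee_zero_right vee_minus_left vee_minus_right vee_diff_left vee_diff_right

lemma vee_sum_left: "(\<Sum>i\<in>I. f i) \<or>\<^sub>C c = (\<Sum>i\<in>I. f i \<or>\<^sub>C c)"
  by (induction I rule: infinite_finite_induct) (simp_all add: vee_linear)

lemma vee_sum_right: "c \<or>\<^sub>C (\<Sum>i\<in>I. f i) = (\<Sum>i\<in>I. c \<or>\<^sub>C f i)"
  by (induction I rule: infinite_finite_induct) (simp_all add: vee_linear)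

lemma vee_axis:
  "axis (S1, T1) 1 \<or>\<^sub>C axis (S2, T2) 1 =
     (-1) ^ (card S2 * card T1) *s (wedge_basis S1 S2 \<otimes>\<^sub>e wedge_basis T1 T2 :: 'a::field cochain)"
  (is "?l = ?r")
proof -
  have "?l = (\<Sum>x\<in>UNIV. \<Sum>y\<in>UNIV. if y = (S2, T2) then (if x = (S1, T1) then ?r else 0) else 0)"
    unfolding vee_def split_def by (intro sum.cong refl) (auto simp: axis_def)
  then show ?thesis by simp
qed

section \<open>Products of monomials\<close>

lemma inv_number_Un_left: "A \<inter> B = {} \<Longrightarrow> inv_number (A \<union> B) C = inv_number A C + inv_number B C"
  unfolding inv_number_def
  by (subst card_Un_disjoint[symmetric]) (auto intro!: arg_cong[where f=card] intro: finite_subset[of _ UNIV])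

lemma inv_number_Un_right: "A \<inter> B = {} \<Longrightarrow> inv_number C (A \<union> B) = inv_number C A + inv_number C B"
  unfolding inv_number_def
  by (subst card_Un_disjoint[symmetric]) (auto intro!: arg_cong[where f=card] intro: finite_subset[of _ UNIV])

lemma inv_number_swap: "A \<inter> B = {} \<Longrightarrow> inv_number A B + inv_number B A = card A * card B"
proof -
  assume d: "A \<inter> B = {}"
  have "inv_number B A = card ((\<lambda>(s, t). (t, s)) ` {(s, t). s \<in> B \<and> t \<in> A \<and> gen_rank t < gen_rank s})"
    unfolding inv_number_def by (rule card_image[symmetric]) (auto simp: inj_on_def)
  also have "(\<lambda>(s, t). (t, s)) ` {(s, t). s \<in> B \<and> t \<in> A \<and> gen_rank t < gen_rank s} =
     {(s, t). s \<in> A \<and> t \<in> B \<and> gen_rank s < gen_rank t}" by auto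
  finally have "inv_number A B + inv_number B A =
    card ({(s, t). s \<in> A \<and> t \<in> B \<and> gen_rank t < gen_rank s} \<union> {(s, t). s \<in> A \<and> t \<in> B \<and> gen_rank s < gen_rank t})"
    unfolding inv_number_def by (subst card_Un_disjoint) (auto intro: finite_subset[of _ UNIV])
  also have "\<dots> = card (A \<times> B)"
    using d by (intro arg_cong[where f=card]) (auto simp: neq_iff[symmetric] gen_rank_inj)
  finally show ?thesis by (simp add: card_cartesian_product)
qed

text \<open>
  A pair in \<open>A \<times> B\<close> that is out of order consists of two covectors, of two vectors, or of a vector from \<open>A\<close>
  and a covector from \<open>B\<close>; the last kind produces the factor \<open>(-1) ^ (p\<^sub>2 q\<^sub>1)\<close>.
\<close>

lemma inv_number_bideg:
  "inv_number A B = inversions (Inl -` A) (Inl -` B) + inversions (Inr -` A) (Inr -` B) +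
     card (Inl -` B) * card (Inr -` A)"
proof -
  let ?X = "{(s, t). s \<in> Inl -` A \<and> t \<in> Inl -` B \<and> t < s}"
  let ?Y = "{(s, t). s \<in> Inr -` A \<and> t \<in> Inr -` B \<and> t < s}"
  have eq: "{(s, t). s \<in> A \<and> t \<in> B \<and> gen_rank t < gen_rank s} =
      (map_prod Inl Inl ` ?X \<union> map_prod Inr Inr ` ?Y) \<union> (\<lambda>(t, s). (Inr s, Inl t)) ` ((Inl -` B) \<times> (Inr -` A))"
    (is "?L = ?R")
  proof (rule set_eqI, clarify)
    fix s t show "(s, t) \<in> ?L \<longleftrightarrow> (s, t) \<in> ?R"
      using hidx_rank_less
      by (cases s; cases t) (auto simp: less_hidx_def image_iff trans_less_add1 not_less less_imp_le dest: less_trans)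
  qed
  show ?thesis unfolding inv_number_def eq inversions_def
    apply (subst card_Un_disjoint)
       apply (auto intro: finite_subset[of _ UNIV])[3]
    apply (subst card_Un_disjoint)
       apply (auto intro: finite_subset[of _ UNIV])[3]
    apply (subst (1 2 3) card_image)
       apply (auto simp: inj_on_def card_cartesian_product)
    done
qed

lemma vee_monomial:
  "monomial A \<or>\<^sub>C monomial B = (if A \<inter> B = {} then (-1) ^ inv_number A B *s (monomial (A \<union> B) :: 'a::field cochain) else 0)"
proof -
  have "A \<inter> B = {} \<longleftrightarrow> Inl -` A \<inter> Inl -` B = {} \<and> Inr -` A \<inter> Inr -` B = {}"
    using bideg_index_inj[of "A \<inter> B" "{}"] by auto
  then show ?thesis
    by (auto simp: monomial_def vee_axis wedge_basis_def tens_simps tens_axis inv_number_bideg power_add mult_ac)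
qed

text \<open>
  On monomials both sides carry the sign of the inversions between the three index sets, because the number
  of inversions is additive in both arguments.
\<close>

lemma vee_assoc: "(a \<or>\<^sub>C b) \<or>\<^sub>C c = a \<or>\<^sub>C (b \<or>\<^sub>C c)"
proof (induction a rule: cochain_basis_induct)
  case (monomial A)
  show ?case
  proof (induction b rule: cochain_basis_induct)
    case (monomial B)
    show ?case
    proof (induction c rule: cochain_basis_induct)
      case (monomial C)
      show ?case
        by (auto simp: vee_monomial vee_linear inv_number_Un_left inv_number_Un_right Int_Un_distrib Int_Un_distrib2
            power_add mult_ac Un_assoc)
    qed (simp_all add: vee_linear)
  qed (simp_all add: vee_linear)
qed (simp_all add: vee_linear)

lemma inv_number_empty [simp]: "inv_number {} A = 0" "inv_number A {} = 0"
  by (simp_all add: inv_number_def)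

lemma vee_one_left: "one_C \<or>\<^sub>C a = a"
  by (induction a rule: cochain_basis_induct) (simp_all add: one_C_monomial vee_monomial vee_linear)

lemma vee_one_right: "a \<or>\<^sub>C one_C = a"
  by (induction a rule: cochain_basis_induct) (simp_all add: one_C_monomial vee_monomial vee_linear)

lemma monomial_insert: "x \<notin> A \<Longrightarrow> monomial (insert x A) = (-1) ^ inv_number {x} A *s (gen x \<or>\<^sub>C monomial A)"
  by (simp add: vee_monomial)

text \<open>
  Identities between linear maps that obey a product rule are proved with this induction: only their effect
  on one generator enters.
\<close>

lemma cochain_gen_induct [case_names add scale one gen]:
  fixes a :: "'a::field cochain"
  assumes add: "\<And>a b. P a \<Longrightarrow> P b \<Longrightarrow> P (a + b)"
    and scale: "\<And>c a. P a \<Longrightarrow> P (c *s a)"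
    and one: "P one_C"
    and gen: "\<And>x a. P a \<Longrightarrow> P (gen x \<or>\<^sub>C a)"
  shows "P a"
proof (induction a rule: cochain_basis_induct)
  case (monomial A)
  have "finite A" by simp
  then show ?case
  proof (induction A rule: finite_induct)
    case (insert x A)
    then show ?case by (subst monomial_insert) (auto intro: scale gen)
  qed (use one in \<open>simp add: one_C_monomial\<close>)
qed (auto intro: add scale)

section \<open>Parity and graded commutativity\<close>

text \<open>
  The grade involution, \<open>1\<close> on even and \<open>-1\<close> on odd cochains. It expresses the signs of super-derivations
  for cochains that need not be homogeneous, such as arbitrary members of a cohomology class.
\<close>

definition grade_inv :: "'a::field cochain \<Rightarrow> 'a cochain" where
  "grade_inv a = (\<chi> ST. (-1) ^ (card (fst ST) + card (snd ST)) * a $ ST)"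

lemma grade_inv_linear: "grade_inv (a + b) = grade_inv a + grade_inv b" "grade_inv (c *s a) = c *s grade_inv a" "grade_inv 0 = 0"
  "grade_inv (- a) = - grade_inv a" "grade_inv (a - b) = grade_inv a - grade_inv b"
  by (simp_all add: grade_inv_def vec_eq_iff algebra_simps)

lemma grade_inv_monomial: "grade_inv (monomial A) = (-1) ^ card A *s monomial A"
  by (auto simp: grade_inv_def vec_eq_iff monomial_def axis_def card_bideg_index)

lemma grade_inv_grade_inv: "grade_inv (grade_inv a) = a"
  by (simp add: grade_inv_def vec_eq_iff flip: mult.assoc)

lemma grade_inv_one: "grade_inv one_C = one_C"
  by (simp add: one_C_monomial grade_inv_monomial)

lemma grade_inv_sum: "grade_inv (\<Sum>i\<in>I. f i) = (\<Sum>i\<in>I. grade_inv (f i))"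
  by (induction I rule: infinite_finite_induct) (simp_all add: grade_inv_linear)

lemma grade_inv_vee: "grade_inv (a \<or>\<^sub>C b) = grade_inv a \<or>\<^sub>C grade_inv b"
proof (induction a rule: cochain_basis_induct)
  case (monomial A)
  show ?case
    by (induction b rule: cochain_basis_induct)
      (simp_all add: grade_inv_linear vee_linear vee_monomial grade_inv_monomial card_Un_disjoint power_add mult_ac)
qed (simp_all add: grade_inv_linear vee_linear)

lemma grade_inv_homogeneous: "a \<in> Cpq p q \<Longrightarrow> grade_inv a = (-1) ^ (p + q) *s a"
  by (fastforce simp: grade_inv_def Cpq_def vec_eq_iff)

text \<open>
  In the expansion by monomials only those of the parity of \<open>a\<close> and \<open>b\<close> occur, and for each of them exchanging
  the factors produces \<open>card A * card B\<close> inversions in total.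
\<close>

lemma vee_graded_commute:
  fixes a b :: "'a::field cochain"
  assumes a: "grade_inv a = (-1) ^ m *s a" and b: "grade_inv b = (-1) ^ n *s b"
  shows "a \<or>\<^sub>C b = (-1) ^ (m * n) *s (b \<or>\<^sub>C a)"
proof -
  have ca: "(-1) ^ card A * a $ bideg_index A = (-1) ^ m * a $ bideg_index A" for A
    using arg_cong[OF a, of "\<lambda>y. y $ bideg_index A"] by (simp add: grade_inv_def card_bideg_index)
  have cb: "(-1) ^ card A * b $ bideg_index A = (-1) ^ n * b $ bideg_index A" for A
    using arg_cong[OF b, of "\<lambda>y. y $ bideg_index A"] by (simp add: grade_inv_def card_bideg_index)
  have "(a $ bideg_index A * b $ bideg_index B) *s (monomial A \<or>\<^sub>C monomial B) =
      (-1) ^ (m * n) *s ((b $ bideg_index B * a $ bideg_index A) *s (monomial B \<or>\<^sub>C monomial A))" for A B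
  proof (cases "a $ bideg_index A = 0 \<or> b $ bideg_index B = 0 \<or> A \<inter> B \<noteq> {}")
    case True then show ?thesis by (auto simp: vee_monomial Int_commute)
  next
    case False
    then have A: "(-1 :: 'a) ^ card A = (-1) ^ m" and B: "(-1 :: 'a) ^ card B = (-1) ^ n"
      using ca cb by auto
    have "(-1 :: 'a) ^ inv_number A B = (-1) ^ (inv_number A B + inv_number B A + inv_number B A)"
      by (simp add: power_add mult.assoc flip: power_mult_distrib)
    also have "\<dots> = (-1) ^ (card A * card B) * (-1) ^ inv_number B A"
      using False inv_number_swap[of A B] by (simp add: power_add)
    also have "(-1 :: 'a) ^ (card A * card B) = (-1) ^ (m * n)"
      by (metis A B power_mult mult.commute)
    finally show ?thesis using False by (auto simp: vee_monomial Un_commute Int_commute mult_ac)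
  qed
  then have "(\<Sum>A\<in>UNIV. \<Sum>B\<in>UNIV. (a $ bideg_index A * b $ bideg_index B) *s (monomial A \<or>\<^sub>C monomial B)) =
    (-1) ^ (m * n) *s (\<Sum>B\<in>UNIV. \<Sum>A\<in>UNIV. (b $ bideg_index B * a $ bideg_index A) *s (monomial B \<or>\<^sub>C monomial A))"
    by (subst sum.swap) (simp add: vec.scale_sum_right)
  moreover have "x \<or>\<^sub>C y = (\<Sum>A\<in>UNIV. \<Sum>B\<in>UNIV. (x $ bideg_index A * y $ bideg_index B) *s (monomial A \<or>\<^sub>C monomial B))"
    for x y :: "'a cochain"
    by (subst cochain_expand[of x], subst cochain_expand[of y])
      (subst sum.swap, simp add: vee_sum_left vee_sum_right vee_linear mult.commute vec.scale_sum_right)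
  ultimately show ?thesis by metis
qed

section \<open>Contractions\<close>

text \<open>
  The left derivative by the generator \<open>x\<close>: it moves \<open>x\<close> to the front of a monomial and deletes it.
\<close>

definition contract :: "hidx + hidx \<Rightarrow> 'a::field cochain \<Rightarrow> 'a cochain" where
  "contract x a = (\<Sum>A | x \<in> A. (a $ bideg_index A * (-1) ^ inv_number {x} (A - {x})) *s monomial (A - {x}))"

lemma monomial_component: "monomial A $ bideg_index B = (if B = A then 1 else 0)"
  unfolding monomial_def axis_def vec_lambda_beta bideg_index_inj ..

lemma contract_linear: "contract x (a + b) = contract x a + contract x b" "contract x (c *s a) = c *s contract x a" "contract x 0 = 0"
  "contract x (- a) = - contract x a" "contract x (a - b) = contract x a - contract x b"
proof -
  show add: "contract x (a + b) = contract x a + contract x b" for a b :: "'a cochain"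
    by (simp add: contract_def distrib_right vec.scale_left_distrib sum.distrib)
  show scale: "contract x (c *s a) = c *s contract x a" for c and a :: "'a cochain"
    by (simp add: contract_def vec.scale_sum_right mult.assoc)
  show "contract x 0 = 0" by (simp add: contract_def)
  show minus: "contract x (- a) = - contract x a" for a :: "'a cochain" using scale[of "- 1" a] by simp
  show "contract x (a - b) = contract x a - contract x b" using add[of a "- b"] by (simp add: minus)
qed

lemma contract_monomial: "contract x (monomial A) =
  (if x \<in> A then (-1) ^ inv_number {x} (A - {x}) *s monomial (A - {x}) else 0)"
proof -
  have "contract x (monomial A) =
    (\<Sum>B | x \<in> B. if A = B then (-1) ^ inv_number {x} (A - {x}) *s monomial (A - {x}) else 0)"
    unfolding contract_def by (rule sum.cong) (auto simp: monomial_component)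
  then show ?thesis by (simp add: sum.delta)
qed

lemma inv_number_single: "inv_number {x} {y} = (if gen_rank y < gen_rank x then 1 else 0)"
proof -
  have "{(s, t). s \<in> {x} \<and> t \<in> {y} \<and> gen_rank t < gen_rank s} = (if gen_rank y < gen_rank x then {(x, y)} else {})"
    by auto
  then show ?thesis by (simp add: inv_number_def)
qed

lemma inv_number_minus: "x \<in> A \<Longrightarrow> inv_number B A = inv_number B {x} + inv_number B (A - {x})"
  using inv_number_Un_right[of "{x}" "A - {x}" B] by (simp add: insert_absorb)

lemma inv_number_insert: "x \<notin> A \<Longrightarrow> inv_number B (insert x A) = inv_number B {x} + inv_number B A"
  using inv_number_Un_right[of "{x}" "A" B] by simp

text \<open>
  The canonical anticommutation relation between multiplication by a generator and contraction. The sign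
  arises because of two different generators exactly one is before the other.
\<close>

lemma contract_gen_vee: "contract x (gen y \<or>\<^sub>C a) = (if x = y then a else 0) - (gen y \<or>\<^sub>C contract x a)"
  for a :: "'a::field cochain"
proof (induction a rule: cochain_basis_induct)
  case (monomial A)
  show ?case
  proof (cases "x \<noteq> y \<and> y \<notin> A \<and> x \<in> A")
    case True
    then have "(-1 :: 'a) ^ inv_number {x} {y} = - ((-1) ^ inv_number {y} {x})"
      using gen_rank_inj[of x y] by (auto simp: inv_number_single)
    moreover have "inv_number {x} (insert y (A - {x})) = inv_number {x} {y} + inv_number {x} (A - {x})"
      using True by (intro inv_number_insert) auto
    moreover have "inv_number {y} A = inv_number {y} {x} + inv_number {y} (A - {x})"
      using True by (intro inv_number_minus) auto
    moreover have "insert y A - {x} = insert y (A - {x})" using True by auto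
    ultimately show ?thesis
      using True by (simp add: vee_monomial contract_linear contract_monomial vee_linear power_add mult_ac)
  next
    case False
    then show ?thesis
      by (auto simp: vee_monomial contract_linear contract_monomial vee_linear insert_absorb)
  qed
qed (simp_all add: contract_linear vee_linear vec.scale_right_diff_distrib)

lemma contract_one: "contract x one_C = 0"
  by (simp add: one_C_monomial contract_monomial)

lemma contract_gen: "contract x (gen y) = (if x = y then one_C else 0)"
  using contract_gen_vee[of x y one_C] by (simp add: contract_one vee_linear vee_one_right)

lemma grade_inv_gen: "grade_inv (gen x) = - gen x"
  by (simp add: grade_inv_monomial)

text \<open>
  Contractions are odd derivations: building up \<open>a\<close> from generators, every step is an instance of the
  anticommutation relation.
\<close>

lemma contract_vee: "contract x (a \<or>\<^sub>C b) = (contract x a \<or>\<^sub>C b) + (grade_inv a \<or>\<^sub>C contract x b)"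
proof (induction a rule: cochain_gen_induct)
  case (gen y a)
  then show ?case by (simp add: vee_assoc contract_gen_vee vee_linear grade_inv_vee grade_inv_gen)
qed (simp_all add: contract_linear vee_linear grade_inv_linear grade_inv_one vee_one_left contract_one algebra_simps vec.scale_right_distrib)

lemma grade_inv_contract: "grade_inv (contract x a) = - contract x (grade_inv a)"
proof (induction a rule: cochain_gen_induct)
  case (gen y a)
  then show ?case by (simp add: contract_gen_vee contract_linear vee_linear grade_inv_linear grade_inv_vee grade_inv_gen)
qed (simp_all add: contract_linear grade_inv_linear grade_inv_one contract_one)

section \<open>Bidegrees\<close>

lemma Cpq_zero: "0 \<in> Cpq p q"
  by (simp add: Cpq_def)

lemma Cpq_add: "a \<in> Cpq p q \<Longrightarrow> b \<in> Cpq p q \<Longrightarrow> a + b \<in> Cpq p q"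
  unfolding Cpq_def by (auto, (metis add.right_neutral add.left_neutral)+)

lemma Cpq_scale: "a \<in> Cpq p q \<Longrightarrow> c *s a \<in> Cpq p q"
  by (auto simp: Cpq_def)

lemma Cpq_sum: "(\<And>i. i \<in> I \<Longrightarrow> f i \<in> Cpq p q) \<Longrightarrow> (\<Sum>i\<in>I. f i) \<in> Cpq p q"
  by (induction I rule: infinite_finite_induct) (simp_all add: Cpq_zero Cpq_add)

lemma monomial_Cpq: "monomial A \<in> Cpq (card (Inl -` A)) (card (Inr -` A))"
  by (auto simp: Cpq_def monomial_def axis_def)

lemma Cpq_induct [consumes 1, case_names add scale monomial]:
  assumes a: "a \<in> Cpq p q"
    and add: "\<And>a b. P a \<Longrightarrow> P b \<Longrightarrow> P (a + b)"
    and scale: "\<And>c a. P a \<Longrightarrow> P (c *s a)"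
    and mono: "\<And>A. card (Inl -` A) = p \<Longrightarrow> card (Inr -` A) = q \<Longrightarrow> P (monomial A)"
    and zero: "P 0"
  shows "P a"
proof -
  have component: "P ((a $ bideg_index A) *s monomial A)" for A
    using a mono scale zero by (cases "a $ bideg_index A = 0") (auto simp: Cpq_def)
  have "finite F \<Longrightarrow> P (\<Sum>A\<in>F. (a $ bideg_index A) *s monomial A)" for F
    by (induction F rule: finite_induct) (auto simp: zero add component)
  then show ?thesis by (subst cochain_expand) simp
qed

lemma vee_Cpq:
  assumes "a \<in> Cpq p1 q1" "b \<in> Cpq p2 q2"
  shows "a \<or>\<^sub>C b \<in> Cpq (p1 + p2) (q1 + q2)"
  using assms(1)
proof (induction rule: Cpq_induct)
  case (monomial A)
  show ?case using assms(2)
  proof (induction rule: Cpq_induct)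
    case (monomial B)
    show ?case
    proof (cases "A \<inter> B = {}")
      case True
      then have "card (Inl -` (A \<union> B)) = p1 + p2" "card (Inr -` (A \<union> B)) = q1 + q2"
        using monomial \<open>card (Inl -` A) = p1\<close> \<open>card (Inr -` A) = q1\<close>
        by (auto simp: vimage_Un intro!: card_Un_disjoint)
      then show ?thesis using True by (metis vee_monomial Cpq_scale monomial_Cpq)
    qed (simp add: vee_monomial Cpq_zero)
  qed (simp_all add: vee_linear Cpq_zero Cpq_add Cpq_scale)
qed (simp_all add: vee_linear Cpq_zero Cpq_add Cpq_scale)

lemma contract_Cpq:
  assumes "a \<in> Cpq p q"
  shows "contract (Inl i) a \<in> Cpq (p - 1) q" "contract (Inr i) a \<in> Cpq p (q - 1)"
    "p = 0 \<Longrightarrow> contract (Inl i) a = 0" "q = 0 \<Longrightarrow> contract (Inr i) a = 0"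
proof -
  have v: "Inl -` (A - {Inl i}) = Inl -` A - {i}" "Inr -` (A - {Inl i}) = Inr -` A"
     "Inl -` (A - {Inr i}) = Inl -` A" "Inr -` (A - {Inr i}) = Inr -` A - {i}"
     for A :: "(hidx + hidx) set" by auto
  show "contract (Inl i) a \<in> Cpq (p - 1) q" using assms
  proof (induction rule: Cpq_induct)
    case (monomial A)
    then show ?case using monomial_Cpq[of "A - {Inl i}"]
      by (auto simp: contract_monomial v Cpq_zero intro!: Cpq_scale)
  qed (simp_all add: contract_linear Cpq_zero Cpq_add Cpq_scale)
  show "contract (Inr i) a \<in> Cpq p (q - 1)" using assms
  proof (induction rule: Cpq_induct)
    case (monomial A)
    then show ?case using monomial_Cpq[of "A - {Inr i}"]
      by (auto simp: contract_monomial v Cpq_zero intro!: Cpq_scale)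
  qed (simp_all add: contract_linear Cpq_zero Cpq_add Cpq_scale)
  show "contract (Inl i) a = 0" if "p = 0" using assms
  proof (induction rule: Cpq_induct)
    case (monomial A)
    then show ?case using that by (auto simp: contract_monomial)
  qed (simp_all add: contract_linear)
  show "contract (Inr i) a = 0" if "q = 0" using assms
  proof (induction rule: Cpq_induct)
    case (monomial A)
    then show ?case using that by (auto simp: contract_monomial)
  qed (simp_all add: contract_linear)
qed

lemma grade_inv_Cpq: "a \<in> Cpq p q \<Longrightarrow> grade_inv a \<in> Cpq p q"
  by (simp add: grade_inv_homogeneous Cpq_scale)

section \<open>Existence of the Poisson bracket\<close>

primrec dual :: "hidx + hidx \<Rightarrow> hidx + hidx" where
  "dual (Inl i) = Inr i"
| "dual (Inr i) = Inl i"

text \<open>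
  The super-bracket of the symmetric pairing on \<open>h\<^sup>* \<oplus> h\<close>. The grade involution is applied after contracting,
  so for homogeneous \<open>a\<close> it contributes the sign \<open>(-1) ^ (p + q - 1)\<close>, which is \<open>1\<close> on generators.
\<close>

definition bracket :: "'a::field cochain \<Rightarrow> 'a cochain \<Rightarrow> 'a cochain" where
  "bracket a b = (\<Sum>x\<in>UNIV. grade_inv (contract x a) \<or>\<^sub>C contract (dual x) b)"

lemma dual_dual [simp]: "dual (dual x) = x"
  by (cases x) auto

lemma bij_dual: "bij dual"
  by (rule involuntory_imp_bij) simp

lemma bracket_linear: "bracket (a + b) c = bracket a c + bracket b c" "bracket (r *s a) c = r *s bracket a c"
  "bracket a (b + c) = bracket a b + bracket a c" "bracket a (r *s c) = r *s bracket a c"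
  by (simp_all add: bracket_def contract_linear grade_inv_linear vee_linear sum.distrib vec.scale_sum_right)

text \<open>
  By the derivation property of contractions it only remains to move \<open>b\<close> to the left across \<open>\<partial>\<^sub>x a\<close>, whose
  parity is opposite to that of \<open>a\<close>.
\<close>

lemma bracket_Leibniz:
  assumes "a \<in> Cpq p1 q1" "b \<in> Cpq p2 q2"
  shows "bracket (a \<or>\<^sub>C b) c = (a \<or>\<^sub>C bracket b c) + (-1) ^ ((p1 + q1) * (p2 + q2)) *s (b \<or>\<^sub>C bracket a c)"
proof -
  let ?m = "p1 + q1" and ?n = "p2 + q2"
  note ha = grade_inv_homogeneous[OF assms(1)] and hb = grade_inv_homogeneous[OF assms(2)]
  \<comment> \<open>the sign \<open>(-1) ^ ?n\<close> comes from \<^term>\<open>grade_inv b\<close>, the other one from exchanging \<open>b\<close> with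
      a factor of parity \<open>?m + 1\<close>\<close>
  have sgn: "(-1 :: 'a) ^ (?m * ?n) = (-1) ^ ?n * (-1) ^ (Suc ?m * ?n)"
    unfolding mult_Suc power_add[of _ ?n] mult.assoc[symmetric] minus_one_mult_self by simp
  have "grade_inv (contract x a) \<or>\<^sub>C grade_inv b = (-1) ^ (?m * ?n) *s (b \<or>\<^sub>C grade_inv (contract x a))" for x
  proof -
    have "grade_inv (grade_inv (contract x a)) = (-1) ^ Suc ?m *s grade_inv (contract x a)"
      by (simp add: grade_inv_grade_inv) (simp add: grade_inv_contract ha contract_linear)
    from vee_graded_commute[OF this hb] show ?thesis
      unfolding hb sgn by (simp add: vee_linear)
  qed
  then have "grade_inv (contract x (a \<or>\<^sub>C b)) \<or>\<^sub>C contract (dual x) c =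
     (-1) ^ (?m * ?n) *s (b \<or>\<^sub>C (grade_inv (contract x a) \<or>\<^sub>C contract (dual x) c)) + (a \<or>\<^sub>C (grade_inv (contract x b) \<or>\<^sub>C contract (dual x) c))" for x
    by (simp add: contract_vee grade_inv_linear grade_inv_vee grade_inv_grade_inv vee_linear flip: vee_assoc)
  then show ?thesis
    by (simp add: bracket_def sum.distrib vee_sum_right vec.scale_sum_right add.commute)
qed

text \<open>
  Reindexing the sum by duality pairs the term of \<open>x\<close> in one bracket with the term of its dual in the other; the
  two differ by exchanging factors whose parities are opposite to those of \<open>a\<close> and \<open>b\<close>.
\<close>

lemma bracket_skew:
  assumes "a \<in> Cpq p1 q1" "b \<in> Cpq p2 q2"
  shows "bracket a b = - ((-1) ^ ((p1 + q1) * (p2 + q2)) *s bracket b a)"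
proof -
  let ?m = "p1 + q1" and ?n = "p2 + q2"
  note ha = grade_inv_homogeneous[OF assms(1)] and hb = grade_inv_homogeneous[OF assms(2)]
  have "bracket b a = (\<Sum>x\<in>UNIV. grade_inv (contract (dual x) b) \<or>\<^sub>C contract x a)"
    unfolding bracket_def by (subst sum.reindex_bij_betw[OF bij_dual, symmetric]) simp
  moreover have "grade_inv (contract x a) \<or>\<^sub>C contract (dual x) b = - ((-1) ^ (?m * ?n) *s (grade_inv (contract (dual x) b) \<or>\<^sub>C contract x a))" for x
  proof -
    have pa: "grade_inv (contract x a) = (-1) ^ Suc ?m *s contract x a" 
      and pb: "grade_inv (contract (dual x) b) = (-1) ^ Suc ?n *s contract (dual x) b"
      by (simp_all add: grade_inv_contract ha hb contract_linear)
    from vee_graded_commute[OF this] show ?thesis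
      unfolding pa pb by (simp add: vee_linear power_add mult_ac)
  qed
  ultimately show ?thesis by (simp add: bracket_def vec.scale_sum_right sum_negf)
qed

lemma vee_Cpq_eq: "a \<in> Cpq p1 q1 \<Longrightarrow> b \<in> Cpq p2 q2 \<Longrightarrow> p1 + p2 = p \<Longrightarrow> q1 + q2 = q \<Longrightarrow> a \<or>\<^sub>C b \<in> Cpq p q"
  using vee_Cpq by blast

text \<open>
  A contraction by a covector lowers \<open>p\<close> and one by a vector lowers \<open>q\<close>, or gives \<open>0\<close> if there is nothing to
  lower; each term of the bracket contains one contraction of either kind.
\<close>

lemma bracket_Cpq:
  assumes a: "a \<in> Cpq p1 q1" and b: "b \<in> Cpq p2 q2"
  shows "if p1 + p2 = 0 \<or> q1 + q2 = 0 then bracket a b = 0 else bracket a b \<in> Cpq (p1 + p2 - 1) (q1 + q2 - 1)"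
proof -
  have 1: "grade_inv (contract (Inl i) a) \<or>\<^sub>C contract (Inr i) b = 0" if "p1 = 0 \<or> q2 = 0" for i
    using that contract_Cpq[OF a] contract_Cpq[OF b] by (auto simp: grade_inv_linear vee_linear)
  have 2: "grade_inv (contract (Inr i) a) \<or>\<^sub>C contract (Inl i) b = 0" if "p2 = 0 \<or> q1 = 0" for i
    using that contract_Cpq[OF a] contract_Cpq[OF b] by (auto simp: grade_inv_linear vee_linear)
  have 3: "grade_inv (contract (Inl i) a) \<or>\<^sub>C contract (Inr i) b \<in> Cpq (p1 + p2 - 1) (q1 + q2 - 1)" for i
    by (cases "p1 = 0 \<or> q2 = 0", simp only: 1 Cpq_zero)
      (auto intro!: vee_Cpq_eq grade_inv_Cpq contract_Cpq a b)
  have 4: "grade_inv (contract (Inr i) a) \<or>\<^sub>C contract (Inl i) b \<in> Cpq (p1 + p2 - 1) (q1 + q2 - 1)" for i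
    by (cases "p2 = 0 \<or> q1 = 0", simp only: 2 Cpq_zero)
      (auto intro!: vee_Cpq_eq grade_inv_Cpq contract_Cpq a b)
  have "bracket a b = (\<Sum>i\<in>UNIV. grade_inv (contract (Inl i) a) \<or>\<^sub>C contract (Inr i) b) + (\<Sum>i\<in>UNIV. grade_inv (contract (Inr i) a) \<or>\<^sub>C contract (Inl i) b)"
    by (simp add: bracket_def sum_gen)
  then show ?thesis
    using Cpq_add[OF Cpq_sum[OF 3] Cpq_sum[OF 4]] 1 2 by auto
qed

lemma vimage_single: "Inl -` {Inl i} = {i}" "Inr -` {Inl i} = {}" "Inl -` {Inr i} = {}" "Inr -` {Inr i} = {i}"
  by auto

lemma tens_one_axis: "axis {i} 1 \<otimes>\<^sub>e ext_one = gen (Inl i)" "ext_one \<otimes>\<^sub>e axis {i} 1 = gen (Inr i)"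
  by (simp_all add: ext_one_def tens_axis monomial_def vimage_single)

lemma of_heis_gen: "of_heis v = (\<Sum>i\<in>UNIV. v $ i *s gen (Inr i))"
  by (simp add: of_heis_def ext_vec_def sum_hidx tens_simps tens_one_axis)

lemma of_heis_dual_gen: "of_heis_dual v = (\<Sum>i\<in>UNIV. v $ i *s gen (Inl i))"
  by (simp add: of_heis_dual_def ext_vec_def sum_hidx tens_simps tens_one_axis)

lemma bracket_gen: "bracket (gen x) (gen y) = (if y = dual x then one_C else 0)"
proof -
  have "bracket (gen x) (gen y) = (\<Sum>z\<in>UNIV. if x = z then (if y = dual x then one_C else 0) else 0)"
    unfolding bracket_def by (rule sum.cong) (auto simp: contract_gen grade_inv_one grade_inv_linear vee_linear vee_one_left)
  then show ?thesis by simp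
qed

lemma linear_scaleI:
  fixes f :: "'a::field ^ 'n \<Rightarrow> 'a ^ 'm"
  shows "(\<And>x y. f (x + y) = f x + f y) \<Longrightarrow> (\<And>c x. f (c *s x) = c *s f x) \<Longrightarrow> Vector_Spaces.linear (*s) (*s) f"
  by (simp add: Vector_Spaces.linear_iff vec.vector_space_axioms)

lemma is_poisson_bracket_bracket: "is_poisson_bracket bracket"
  unfolding is_poisson_bracket_def
proof (intro conjI allI ballI)
  show "Vector_Spaces.linear (*s) (*s) (bracket a)" for a :: "'a cochain"
    by (rule linear_scaleI) (simp_all add: bracket_linear)
  show "Vector_Spaces.linear (*s) (*s) (\<lambda>a. bracket a b)" for b :: "'a cochain"
    by (rule linear_scaleI) (simp_all add: bracket_linear)
next
  fix p1 q1 p2 q2 :: nat and a b c :: "'a cochain" assume ab: "a \<in> Cpq p1 q1" "b \<in> Cpq p2 q2"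
  show "if p1 + p2 = 0 \<or> q1 + q2 = 0 then bracket a b = 0 else bracket a b \<in> Cpq (p1 + p2 - 1) (q1 + q2 - 1)"
    by (rule bracket_Cpq[OF ab])
  show "bracket a b = - ((-1) ^ ((p1 + q1) * (p2 + q2)) *s bracket b a)"
    by (rule bracket_skew[OF ab])
  show "bracket (a \<or>\<^sub>C b) c = (a \<or>\<^sub>C bracket b c) + (-1) ^ ((p1 + q1) * (p2 + q2)) *s (b \<or>\<^sub>C bracket a c)"
    by (rule bracket_Leibniz[OF ab])
qed (simp_all add: of_heis_gen of_heis_dual_gen sum_hidx bracket_linear bracket_gen pairing_def
      vec.scale_left_distrib vec.scale_right_distrib mult.commute)

section \<open>Uniqueness of the Poisson bracket\<close>

lemma gen_Cpq: "gen (Inl i) \<in> Cpq 1 0" "gen (Inr i) \<in> Cpq 0 1"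
  using monomial_Cpq[of "{Inl i}"] monomial_Cpq[of "{Inr i}"] by (simp_all add: vimage_single)

lemma gen_of_heis: "gen (Inr i) = of_heis (axis i 1)" "gen (Inl i) = of_heis_dual (axis i 1)"
  by (cases i; simp add: of_heis_gen of_heis_dual_gen sum_hidx axis_def)+

text \<open>
  The axioms fix the bracket of two generators. By the Leibniz rule they fix the bracket of a monomial with a
  generator, by skew-symmetry that of a generator with a monomial, and by the Leibniz rule once more that
  of two monomials.
\<close>

lemma poisson_bracket_unique:
  fixes B B' :: "'a::field cochain \<Rightarrow> 'a cochain \<Rightarrow> 'a cochain"
  assumes B: "is_poisson_bracket B" and B': "is_poisson_bracket B'"
  shows "B = B'"
proof -
  have lin: "F a (b + c) = F a b + F a c" "F (a + b) c = F a c + F b c" "F a (r *s c) = r *s F a c" "F (r *s a) c = r *s F a c"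
    if "is_poisson_bracket F" for F :: "'a cochain \<Rightarrow> 'a cochain \<Rightarrow> 'a cochain" and a b c r
  proof -
    have "Vector_Spaces.linear (*s) (*s) (F a)" "Vector_Spaces.linear (*s) (*s) (\<lambda>a. F a c)" for a c
      using that unfolding is_poisson_bracket_def by simp_all
    then show "F a (b + c) = F a b + F a c" "F (a + b) c = F a c + F b c"
        "F a (r *s c) = r *s F a c" "F (r *s a) c = r *s F a c"
      by (simp_all add: Vector_Spaces.linear_iff)
  qed
  have leib: "F (a \<or>\<^sub>C b) c = (a \<or>\<^sub>C F b c) + (-1) ^ ((p1 + q1) * (p2 + q2)) *s (b \<or>\<^sub>C F a c)"
    if "is_poisson_bracket F" "a \<in> Cpq p1 q1" "b \<in> Cpq p2 q2"
    for F :: "'a cochain \<Rightarrow> 'a cochain \<Rightarrow> 'a cochain" and a b c p1 q1 p2 q2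
    using that unfolding is_poisson_bracket_def by blast
  have skew: "F a b = - ((-1) ^ ((p1 + q1) * (p2 + q2)) *s F b a)"
    if "is_poisson_bracket F" "a \<in> Cpq p1 q1" "b \<in> Cpq p2 q2"
    for F :: "'a cochain \<Rightarrow> 'a cochain \<Rightarrow> 'a cochain" and a b p1 q1 p2 q2
    using that unfolding is_poisson_bracket_def by blast
  have gens: "B (gen x) (gen y) = B' (gen x) (gen y)" for x y
    using B B' unfolding is_poisson_bracket_def
    by (cases x; cases y) (simp_all only: gen_of_heis)
  have one: "F one_C c = 0" if "is_poisson_bracket F" for F :: "'a cochain \<Rightarrow> 'a cochain \<Rightarrow> 'a cochain" and c
  proof -
    have "one_C \<in> Cpq 0 0" using monomial_Cpq[of "{}"] by (simp add: one_C_monomial)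
    from leib[OF that this this, of c] show ?thesis by (simp add: vee_one_left)
  qed
  have step: "B (monomial A) c = B' (monomial A) c" if c: "\<And>x. B (gen x) c = B' (gen x) c" for A c
  proof -
    have "finite A" by simp
    then show ?thesis
    proof (induction A rule: finite_induct)
      case empty
      show ?case using one[OF B] one[OF B'] by (simp add: one_C_monomial)
    next
      case (insert x A)
      obtain p q where "gen x \<in> (Cpq p q :: 'a cochain set)" using gen_Cpq by (cases x) blast+
      note l = leib[OF _ this monomial_Cpq]
      show ?case
        unfolding monomial_insert[OF insert(2)] lin(4)[OF B] lin(4)[OF B'] l[OF B] l[OF B'] insert.IH c ..
    qed
  qed
  have "B (gen x) (monomial A) = B' (gen x) (monomial A)" for x A
  proof -
    obtain p q where "gen x \<in> (Cpq p q :: 'a cochain set)" using gen_Cpq by (cases x) blast+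
    note s = skew[OF _ this monomial_Cpq]
    show ?thesis unfolding s[OF B] s[OF B'] by (simp add: step gens)
  qed
  then have monomials: "B (monomial A) (monomial A') = B' (monomial A) (monomial A')" for A A'
    by (rule step)
  have right: "B (monomial A) b = B' (monomial A) b" for A b
    by (induction b rule: cochain_basis_induct) (simp_all add: lin[OF B] lin[OF B'] monomials)
  have "B a b = B' a b" for a b
    by (induction a rule: cochain_basis_induct) (simp_all add: lin[OF B] lin[OF B'] right)
  then show ?thesis by blast
qed

lemma poisson_eq_bracket: "poisson = bracket"
  unfolding poisson_def
proof (rule the_equality)
  show "is_poisson_bracket bracket" by (rule is_poisson_bracket_bracket)
  show "B = bracket" if "is_poisson_bracket B" for B :: "'a cochain \<Rightarrow> 'a cochain \<Rightarrow> 'a cochain"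
    using that is_poisson_bracket_bracket by (rule poisson_bracket_unique)
qed

section \<open>The differential\<close>

text \<open>
  Here \<open>u\<close> is for the upper indices of the dual basis and \<open>d\<close> for the lower ones of the basis, as in the
  abbreviations for the corresponding elements of the exterior algebras.
\<close>

abbreviation "Xum1 \<equiv> gen (Inl I1)"
abbreviation "Xu1 \<equiv> gen (Inl Im1)"
abbreviation "Hu0 \<equiv> gen (Inl I0)"
abbreviation "Xd1 \<equiv> gen (Inr I1)"
abbreviation "Xdm1 \<equiv> gen (Inr Im1)"
abbreviation "Hd0 \<equiv> gen (Inr I0)"

lemma wedge_linear:
  "(x + y) \<and>\<^sub>e w = (x \<and>\<^sub>e w) + (y \<and>\<^sub>e w)" "x \<and>\<^sub>e (y + w) = (x \<and>\<^sub>e y) + (x \<and>\<^sub>e w)"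
  "(c *s x) \<and>\<^sub>e w = c *s (x \<and>\<^sub>e w)" "x \<and>\<^sub>e (c *s w) = c *s (x \<and>\<^sub>e w)"
  by (simp_all add: wedge_def distrib_right distrib_left vec.scale_left_distrib sum.distrib
      vec.scale_sum_right mult.assoc mult.left_commute[of _ c])

lemma wedge_axis: "axis S 1 \<and>\<^sub>e axis T 1 = wedge_basis S T"
proof -
  have "axis S 1 \<and>\<^sub>e axis T 1 =
    (\<Sum>S'\<in>UNIV. \<Sum>T'\<in>UNIV. if T' = T then (if S' = S then wedge_basis S T else 0) else 0)"
    unfolding wedge_def by (intro sum.cong refl) (auto simp: axis_def)
  then show ?thesis by simp
qed

lemma wedge_basis_empty: "wedge_basis {} T = axis T 1" "wedge_basis S {} = axis S 1"
  by (simp_all add: wedge_basis_def inversions_def)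

lemma tens_wedge_one: "(\<phi> \<and>\<^sub>e \<psi>) \<otimes>\<^sub>e ext_one = (\<phi> \<otimes>\<^sub>e ext_one) \<or>\<^sub>C (\<psi> \<otimes>\<^sub>e ext_one)"
proof (induction \<phi> rule: axis_induct)
  case (axis S)
  show ?case
  proof (induction \<psi> rule: axis_induct)
    case (axis T)
    show ?case by (simp add: ext_one_def wedge_axis tens_axis vee_axis wedge_basis_empty)
  qed (simp_all add: wedge_linear tens_simps vee_linear)
qed (simp_all add: wedge_linear tens_simps vee_linear)

lemma tens_one_wedge: "ext_one \<otimes>\<^sub>e (x \<and>\<^sub>e y) = (ext_one \<otimes>\<^sub>e x) \<or>\<^sub>C (ext_one \<otimes>\<^sub>e y)"
proof (induction x rule: axis_induct)
  case (axis S)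
  show ?case
  proof (induction y rule: axis_induct)
    case (axis T)
    show ?case by (simp add: ext_one_def wedge_axis tens_axis vee_axis wedge_basis_empty)
  qed (simp_all add: wedge_linear tens_simps vee_linear)
qed (simp_all add: wedge_linear tens_simps vee_linear)

lemma tens_eq_vee: "\<phi> \<otimes>\<^sub>e x = (\<phi> \<otimes>\<^sub>e ext_one) \<or>\<^sub>C (ext_one \<otimes>\<^sub>e x)"
proof (induction \<phi> rule: axis_induct)
  case (axis S)
  show ?case
  proof (induction x rule: axis_induct)
    case (axis T)
    show ?case by (simp add: ext_one_def tens_axis vee_axis wedge_basis_empty)
  qed (simp_all add: tens_simps vee_linear)
qed (simp_all add: tens_simps vee_linear)

lemma tens_words:
  "(axis S 1 \<and>\<^sub>e \<psi>) \<otimes>\<^sub>e x = (axis S 1 \<otimes>\<^sub>e ext_one) \<or>\<^sub>C (\<psi> \<otimes>\<^sub>e x)"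
  "axis {i} 1 \<otimes>\<^sub>e axis {j} 1 = gen (Inl i) \<or>\<^sub>C gen (Inr j)"
  "axis {i} 1 \<otimes>\<^sub>e (x \<and>\<^sub>e y) = gen (Inl i) \<or>\<^sub>C (ext_one \<otimes>\<^sub>e (x \<and>\<^sub>e y))"
  by (subst (1 2) tens_eq_vee, simp add: tens_wedge_one vee_assoc)
    (subst tens_eq_vee, simp add: tens_one_axis)+

lemmas to_words = tens_words tens_one_wedge tens_one_axis vee_assoc

lemma mu_words: "mu = Xum1 \<or>\<^sub>C (Xu1 \<or>\<^sub>C Hd0)"
  by (simp add: mu_def to_words)

lemma gen_anticommute: "gen x \<or>\<^sub>C gen y = - (gen y \<or>\<^sub>C gen x)"
  using vee_graded_commute[of "gen x" 1 "gen y" 1] by (simp add: grade_inv_gen)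

lemma gen_sq: "gen x \<or>\<^sub>C gen x = 0" "gen x \<or>\<^sub>C (gen x \<or>\<^sub>C c) = 0"
  by (simp_all add: vee_monomial vee_linear flip: vee_assoc)

lemma gen_swap:
  assumes "gen_rank y < gen_rank x"
  shows "gen x \<or>\<^sub>C gen y = - (gen y \<or>\<^sub>C gen x)"
    "gen x \<or>\<^sub>C (gen y \<or>\<^sub>C c) = - (gen y \<or>\<^sub>C (gen x \<or>\<^sub>C c))"
proof -
  show "gen x \<or>\<^sub>C gen y = - (gen y \<or>\<^sub>C gen x)" by (rule gen_anticommute)
  from arg_cong[OF this, of "\<lambda>w. w \<or>\<^sub>C c"]
  show "gen x \<or>\<^sub>C (gen y \<or>\<^sub>C c) = - (gen y \<or>\<^sub>C (gen x \<or>\<^sub>C c))"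
    by (simp only: vee_assoc vee_minus_left)
qed

text \<open>
  As rewrite rules these bring a word into increasing order, or to \<open>0\<close> if a letter is repeated: the
  swapping rule has the condition that the two letters are out of order, so that it terminates.
\<close>

lemmas normal_order = vee_assoc vee_linear gen_sq gen_swap vee_one_left vee_one_right

lemma vee_even_commute: "grade_inv w = w \<Longrightarrow> w \<or>\<^sub>C a = a \<or>\<^sub>C w"
proof (induction a rule: cochain_gen_induct)
  case (gen x a)
  have "w \<or>\<^sub>C gen x = gen x \<or>\<^sub>C w"
    using vee_graded_commute[of w 0 "gen x" 1] gen.prems by (simp add: grade_inv_gen)
  then show ?case using gen by (metis vee_assoc)
qed (simp_all add: vee_linear vee_one_left vee_one_right)

text \<open>
  The three terms of \<open>{\<mu>, -}\<close> come from contracting \<open>\<mu> = x\<^sup>-\<^sup>1 x\<^sup>1 h\<^sub>0\<close> by its three letters.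
\<close>

lemma ce_d_eq:
  "ce_d a = ((Xu1 \<or>\<^sub>C Hd0) \<or>\<^sub>C contract (Inr I1) a) - ((Xum1 \<or>\<^sub>C Hd0) \<or>\<^sub>C contract (Inr Im1) a)
     + ((Xum1 \<or>\<^sub>C Xu1) \<or>\<^sub>C contract (Inl I0) a)"
  unfolding ce_d_def poisson_eq_bracket bracket_def sum_gen sum_hidx mu_words
  by (simp add: contract_gen_vee contract_gen grade_inv_linear grade_inv_vee grade_inv_gen grade_inv_one normal_order)

lemma ce_d_linear: "ce_d (a + b) = ce_d a + ce_d b" "ce_d (c *s a) = c *s ce_d a" "ce_d 0 = 0"
  "ce_d (- a) = - ce_d a" "ce_d (a - b) = ce_d a - ce_d b"
  by (simp_all add: ce_d_eq contract_linear vee_linear vec.scale_right_distrib vec.scale_right_diff_distrib)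

text \<open>
  Each summand of \<open>d\<close> is a contraction followed by multiplication with a product of two generators, and the
  latter is even, hence central.
\<close>

lemma ce_d_vee: "ce_d (a \<or>\<^sub>C b) = (ce_d a \<or>\<^sub>C b) + (grade_inv a \<or>\<^sub>C ce_d b)"
proof -
  have c: "gen x \<or>\<^sub>C (gen y \<or>\<^sub>C (grade_inv a \<or>\<^sub>C c)) = grade_inv a \<or>\<^sub>C (gen x \<or>\<^sub>C (gen y \<or>\<^sub>C c))" for x y c
    using vee_even_commute[of "gen x \<or>\<^sub>C gen y" "grade_inv a"]
    by (simp add: grade_inv_vee grade_inv_gen vee_linear flip: vee_assoc)
  show ?thesis
    by (simp only: ce_d_eq contract_vee vee_add_right vee_diff_right vee_add_left vee_diff_left c vee_assoc)
      (simp add: algebra_simps)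
qed

lemma grade_inv_ce_d: "grade_inv (ce_d a) = - ce_d (grade_inv a)"
  by (simp add: ce_d_eq grade_inv_linear grade_inv_vee grade_inv_gen grade_inv_contract vee_linear)

lemma ce_d_gen:
  "ce_d Xum1 = 0" "ce_d Xu1 = 0" "ce_d Hu0 = Xum1 \<or>\<^sub>C Xu1"
  "ce_d Xd1 = Xu1 \<or>\<^sub>C Hd0" "ce_d Xdm1 = - (Xum1 \<or>\<^sub>C Hd0)" "ce_d Hd0 = 0" "ce_d one_C = 0"
  by (simp_all add: ce_d_eq contract_gen contract_one vee_linear vee_one_right)

section \<open>Cohomology classes\<close>

lemma ce_d_range_subspace:
  "0 \<in> range ce_d" "a \<in> range ce_d \<Longrightarrow> b \<in> range ce_d \<Longrightarrow> a + b \<in> range ce_d"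
  "a \<in> range ce_d \<Longrightarrow> c *s a \<in> range ce_d" "a \<in> range ce_d \<Longrightarrow> - a \<in> range ce_d"
  using rangeI[of ce_d 0] by (auto simp: ce_d_linear(3) simp flip: ce_d_linear(1,2,4))

lemma cocycles_subspace:
  "0 \<in> cocycles" "a \<in> cocycles \<Longrightarrow> b \<in> cocycles \<Longrightarrow> a + b \<in> cocycles" "a \<in> cocycles \<Longrightarrow> c *s a \<in> cocycles"
  by (simp_all add: cocycles_def ce_d_linear)

lemma coh_rel_iff: "(a, b) \<in> coh_rel \<longleftrightarrow> a \<in> cocycles \<and> b \<in> cocycles \<and> a - b \<in> range ce_d"
  by (simp add: coh_rel_def)

lemma equiv_coh_rel: "equiv cocycles (coh_rel :: ('a::field cochain \<times> 'a cochain) set)" (is "equiv ?C ?R")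
proof (rule equivI)
  show "?R \<subseteq> ?C \<times> ?C" by (auto simp: coh_rel_iff)
  show "refl_on ?C ?R" by (auto simp: refl_on_def coh_rel_iff ce_d_range_subspace)
  show "sym ?R"
    by (rule symI) (metis coh_rel_iff ce_d_range_subspace(4) minus_diff_eq)
  show "trans ?R"
  proof (rule transI)
    fix x y z :: "'a cochain" assume "(x, y) \<in> coh_rel" "(y, z) \<in> coh_rel"
    then show "(x, z) \<in> coh_rel"
      using ce_d_range_subspace(2)[of "x - y" "y - z"] by (simp add: coh_rel_iff)
  qed
qed

lemma coh_class_eq_iff:
  "a \<in> cocycles \<Longrightarrow> b \<in> cocycles \<Longrightarrow> coh_class a = coh_class b \<longleftrightarrow> a - b \<in> range ce_d"
  using eq_equiv_class_iff[OF equiv_coh_rel, of a b] by (simp add: coh_rel_iff)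

text \<open>
  Operations on classes are defined as unions over representatives; if all representatives give the
  same class, this union is that class.
\<close>

lemma coh_lift_class:
  assumes a: "a \<in> cocycles" and
    f: "\<And>x. x \<in> cocycles \<Longrightarrow> a - x \<in> range ce_d \<Longrightarrow> coh_class (f x) = coh_class (f a)"
  shows "(\<Union>x\<in>coh_class a. coh_class (f x)) = coh_class (f a)"
proof -
  have "a \<in> coh_class a" using a by (simp add: coh_rel_iff ce_d_range_subspace)
  then show ?thesis
    by (rule UN_constant_eq) (rule ballI, rule f; simp add: coh_rel_iff)
qed

lemma coh_scale_class: "a \<in> cocycles \<Longrightarrow> coh_scale c (coh_class a) = coh_class (c *s a)"
  unfolding coh_scale_def
proof (rule coh_lift_class)
  fix x assume x: "a \<in> cocycles" "x \<in> cocycles" "a - x \<in> range ce_d"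
  then have "c *s x - c *s a = (- c) *s (a - x)" by (simp add: vec.scale_right_diff_distrib)
  then show "coh_class (c *s x) = coh_class (c *s a)"
    using x by (simp add: coh_class_eq_iff cocycles_subspace ce_d_range_subspace)
qed

lemma coh_lift_class2:
  assumes a: "a \<in> cocycles" and b: "b \<in> cocycles" and
    f: "\<And>x y. x \<in> cocycles \<Longrightarrow> y \<in> cocycles \<Longrightarrow> a - x \<in> range ce_d \<Longrightarrow> b - y \<in> range ce_d \<Longrightarrow>
          coh_class (f x y) = coh_class (f a b)"
  shows "(\<Union>x\<in>coh_class a. \<Union>y\<in>coh_class b. coh_class (f x y)) = coh_class (f a b)"
proof -
  have "a \<in> coh_class a" "b \<in> coh_class b" using a b by (simp_all add: coh_rel_iff ce_d_range_subspace)
  have inner: "(\<Union>y\<in>coh_class b. coh_class (f x y)) = coh_class (f a b)" if "x \<in> coh_class a" for x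
    using \<open>b \<in> coh_class b\<close>
    by (rule UN_constant_eq) (rule ballI, rule f; use that in \<open>simp add: coh_rel_iff\<close>)
  show ?thesis
    using \<open>a \<in> coh_class a\<close> by (rule UN_constant_eq) (rule ballI, rule inner)
qed

lemma coh_add_class:
  assumes a: "a \<in> cocycles" and b: "b \<in> cocycles"
  shows "coh_add (coh_class a) (coh_class b) = coh_class (a + b)"
  unfolding coh_add_def using a b
proof (rule coh_lift_class2)
  fix x y assume x: "x \<in> cocycles" "y \<in> cocycles" "a - x \<in> range ce_d" "b - y \<in> range ce_d"
  have "x + y - (a + b) = - ((a - x) + (b - y))" by simp
  then show "coh_class (x + y) = coh_class (a + b)"
    using x a b by (metis coh_class_eq_iff cocycles_subspace(2) ce_d_range_subspace(2,4))
qed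

lemma cocycles_vee: "a \<in> cocycles \<Longrightarrow> b \<in> cocycles \<Longrightarrow> a \<or>\<^sub>C b \<in> cocycles"
  by (simp add: cocycles_def ce_d_vee vee_linear)

lemma exact_vee: "a \<in> range ce_d \<Longrightarrow> b \<in> cocycles \<Longrightarrow> a \<or>\<^sub>C b \<in> range ce_d"
proof clarify
  fix c assume "b \<in> cocycles"
  then have "ce_d c \<or>\<^sub>C b = ce_d (c \<or>\<^sub>C b)" by (simp add: ce_d_vee cocycles_def vee_linear)
  then show "ce_d c \<or>\<^sub>C b \<in> range ce_d" by simp
qed

text \<open>
  If \<open>b = d c\<close>, a primitive is the product of \<open>c\<close> with \<open>a\<close> after its odd part has been negated; that is a
  cocycle together with \<open>a\<close> because the grade involution anticommutes with \<open>d\<close>.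
\<close>

lemma vee_exact: "a \<in> cocycles \<Longrightarrow> b \<in> range ce_d \<Longrightarrow> a \<or>\<^sub>C b \<in> range ce_d"
proof clarify
  fix c assume "a \<in> cocycles"
  then have "ce_d (grade_inv a) = 0" using grade_inv_ce_d[of a] by (simp add: cocycles_def grade_inv_linear)
  then have "a \<or>\<^sub>C ce_d c = ce_d (grade_inv a \<or>\<^sub>C c)" by (simp add: ce_d_vee grade_inv_grade_inv vee_linear)
  then show "a \<or>\<^sub>C ce_d c \<in> range ce_d" by simp
qed

lemma cup_class:
  assumes a: "a \<in> cocycles" and b: "b \<in> cocycles"
  shows "cup (coh_class a) (coh_class b) = coh_class (a \<or>\<^sub>C b)"
  unfolding cup_def using a b
proof (rule coh_lift_class2)
  fix x y assume x: "x \<in> cocycles" "y \<in> cocycles" "a - x \<in> range ce_d" "b - y \<in> range ce_d"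
  have "(x \<or>\<^sub>C y) - (a \<or>\<^sub>C b) = - (((a - x) \<or>\<^sub>C y) + (a \<or>\<^sub>C (b - y)))"
    by (simp add: vee_linear)
  also have "\<dots> \<in> range ce_d"
    using x a by (intro ce_d_range_subspace exact_vee vee_exact)
  finally show "coh_class (x \<or>\<^sub>C y) = coh_class (a \<or>\<^sub>C b)"
    using x a b by (simp add: coh_class_eq_iff cocycles_vee)
qed

section \<open>The action of SL(2) on cochains\<close>

lemma cochain_act_linear: "cochain_act g (a + b) = cochain_act g a + cochain_act g b"
  "cochain_act g (c *s a) = c *s cochain_act g a"
  by (simp_all add: cochain_act_def split_def vec.scale_left_distrib sum.distrib vec.scale_sum_right)

lemma cochain_act_zero: "cochain_act g 0 = 0"
  using cochain_act_linear(2)[of g 0 0] by simp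

lemma cochain_act_minus: "cochain_act g (- a) = - cochain_act g a"
  using cochain_act_linear(2)[of g "-1" a] by simp

lemma cochain_act_diff: "cochain_act g (a - b) = cochain_act g a - cochain_act g b"
  using cochain_act_linear(1)[of g a "- b"] by (simp add: cochain_act_minus)

lemma cochain_act_axis:
  "cochain_act g (axis (S, T) 1) = ext_map_basis (heis_dual_act g) S \<otimes>\<^sub>e ext_map_basis (heis_act g) T"
proof -
  have "cochain_act g (axis (S, T) 1) = (\<Sum>ST\<in>UNIV. if ST = (S, T) then
      ext_map_basis (heis_dual_act g) S \<otimes>\<^sub>e ext_map_basis (heis_act g) T else 0)"
    unfolding cochain_act_def by (intro sum.cong refl) (simp add: axis_def split_def prod_eq_iff)
  then show ?thesis by simp
qed

primrec gen_act :: "'a::field ^ 2 ^ 2 \<Rightarrow> hidx + hidx \<Rightarrow> 'a cochain" where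
  "gen_act g (Inl i) = of_heis_dual (heis_dual_act g (axis i 1))"
| "gen_act g (Inr i) = of_heis (heis_act g (axis i 1))"

abbreviation ordered_prod :: "(hidx \<Rightarrow> 'a::field cochain) \<Rightarrow> hidx list \<Rightarrow> 'a cochain \<Rightarrow> 'a cochain" where
  "ordered_prod G xs c \<equiv> foldr (\<lambda>i c. G i \<or>\<^sub>C c) xs c"

lemma ordered_prod_vee: "ordered_prod G xs (c \<or>\<^sub>C c') = ordered_prod G xs c \<or>\<^sub>C c'"
  by (induction xs) (simp_all add: vee_assoc)

lemma ordered_prod_scale: "ordered_prod G xs (r *s c) = r *s ordered_prod G xs c"
  by (induction xs) (simp_all add: vee_linear)

lemma ordered_prod_zero: "ordered_prod G xs 0 = 0"
  by (induction xs) (simp_all add: vee_linear)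

lemma cochain_act_monomial:
  "cochain_act g (monomial A) =
     ordered_prod (\<lambda>i. gen_act g (Inl i)) (sorted_list_of_set (Inl -` A))
       (ordered_prod (\<lambda>i. gen_act g (Inr i)) (sorted_list_of_set (Inr -` A)) one_C)"
proof -
  have l: "foldr (\<lambda>i y. ext_vec (L i) \<and>\<^sub>e y) xs ext_one \<otimes>\<^sub>e ext_one = ordered_prod (\<lambda>i. of_heis_dual (L i)) xs one_C"
    for L :: "hidx \<Rightarrow> 'a heis" and xs
    by (induction xs) (simp_all add: tens_wedge_one of_heis_dual_def)
  have r: "ext_one \<otimes>\<^sub>e foldr (\<lambda>i y. ext_vec (L i) \<and>\<^sub>e y) xs ext_one = ordered_prod (\<lambda>i. of_heis (L i)) xs one_C"
    for L :: "hidx \<Rightarrow> 'a heis" and xs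
    by (induction xs) (simp_all add: tens_one_wedge of_heis_def)
  show ?thesis
    unfolding monomial_def cochain_act_axis ext_map_basis_def
    by (subst tens_eq_vee) (simp add: l r vee_one_left flip: ordered_prod_vee)
qed

text \<open>
  Inserting a factor at its place in an increasing product of anticommuting elements costs one sign per
  smaller factor, the same as for the generators themselves.
\<close>

lemma vee_ordered_prod:
  assumes swap: "\<And>i j c. G i \<or>\<^sub>C (G j \<or>\<^sub>C c) = - (G j \<or>\<^sub>C (G i \<or>\<^sub>C c))"
    and sq: "\<And>i c. G i \<or>\<^sub>C (G i \<or>\<^sub>C c) = 0"
    and xs: "sorted xs" "distinct xs"
  shows "G i \<or>\<^sub>C ordered_prod G xs c =
    (if i \<in> set xs then 0 else (-1) ^ card {j \<in> set xs. j < i} *s ordered_prod G (insort i xs) c)"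
  using xs
proof (induction xs)
  case (Cons y ys)
  show ?case
  proof (cases i y rule: linorder_cases)
    case equal then show ?thesis by (simp add: sq)
  next
    case less
    then have "i \<notin> set (y # ys)" and none: "{j \<in> set (y # ys). j < i} = {}" using Cons.prems by auto
    then show ?thesis unfolding none using less by (simp add: less_imp_le)
  next
    case greater
    have "{j \<in> set (y # ys). j < i} = insert y {j \<in> set ys. j < i}" using greater by auto
    then have "card {j \<in> set (y # ys). j < i} = Suc (card {j \<in> set ys. j < i})"
      using Cons.prems by simp
    moreover have "G i \<or>\<^sub>C ordered_prod G (y # ys) c = - (G y \<or>\<^sub>C (G i \<or>\<^sub>C ordered_prod G ys c))"
      by (simp add: swap[of i y])
    ultimately show ?thesis
      using Cons greater by (auto simp: vee_linear simp del: swap)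
  qed
qed simp

lemma grade_inv_gen_act: "grade_inv (gen_act g x) = - gen_act g x"
  by (cases x) (simp_all add: of_heis_gen of_heis_dual_gen grade_inv_sum grade_inv_linear grade_inv_gen sum_negf)

lemma gen_act_swap: "gen_act g x \<or>\<^sub>C gen_act g y = - (gen_act g y \<or>\<^sub>C gen_act g x)"
  using vee_graded_commute[of "gen_act g x" 1 "gen_act g y" 1] by (simp add: grade_inv_gen_act)

lemma gen_act_swap_left: "gen_act g x \<or>\<^sub>C (gen_act g y \<or>\<^sub>C c) = - (gen_act g y \<or>\<^sub>C (gen_act g x \<or>\<^sub>C c))"
  using arg_cong[OF gen_act_swap[of g x y], of "\<lambda>w. w \<or>\<^sub>C c"] by (simp only: vee_assoc vee_minus_left)

lemma gen_act_sq_left: "gen_act g x \<or>\<^sub>C (gen_act g x \<or>\<^sub>C c) = 0" for g :: "'a::field_char_0 ^ 2 ^ 2"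
proof -
  have "gen_act g x \<or>\<^sub>C gen_act g x = 0"
    using gen_act_swap[of g x x] by (simp add: vec_eq_iff eq_neg_iff_add_eq_0 mult_2[symmetric])
  then show ?thesis by (simp add: vee_linear flip: vee_assoc)
qed

lemma inversions_single: "inversions {i} S = card {j \<in> S. j < i}"
proof -
  have "{(s, t). s \<in> {i} \<and> t \<in> S \<and> t < s} = Pair i ` {j \<in> S. j < i}" by auto
  then show ?thesis unfolding inversions_def by (simp only:) (simp add: card_image inj_on_def)
qed

lemma inversions_empty: "inversions {} S = 0" by (simp add: inversions_def)

text \<open>
  The action is defined on monomials by ordered products of the images of the generators. These
  images are odd and so anticommute like the generators; hence multiplying by one more of them reproduces
  the sign in the product of monomials. A vector has to pass all covectors before it is inserted.
\<close>

lemma cochain_act_gen_vee: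
  fixes g :: "'a::field_char_0 ^ 2 ^ 2"
  shows "cochain_act g (gen x \<or>\<^sub>C a) = gen_act g x \<or>\<^sub>C cochain_act g a"
proof (induction a rule: cochain_basis_induct)
  case (monomial A)
  note insl = vee_ordered_prod[of "\<lambda>i. gen_act g (Inl i)", OF gen_act_swap_left gen_act_sq_left sorted_sorted_list_of_set distinct_sorted_list_of_set]
  note insr = vee_ordered_prod[of "\<lambda>i. gen_act g (Inr i)", OF gen_act_swap_left gen_act_sq_left sorted_sorted_list_of_set distinct_sorted_list_of_set]
  show ?case
  proof (cases x)
    case (Inl i)
    have "Inl -` insert (Inl i) A = insert i (Inl -` A)" "Inr -` insert (Inl i) A = Inr -` A" by auto
    then show ?thesis
      by (simp add: Inl vee_monomial cochain_act_monomial cochain_act_zero cochain_act_linear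
          insl inv_number_bideg vimage_single inversions_single inversions_empty
          del: gen_act.simps)
  next
    case (Inr i)
    have v: "Inr -` insert (Inr i) A = insert i (Inr -` A)" "Inl -` insert (Inr i) A = Inl -` A" by auto
    have "gen_act g (Inr i) \<or>\<^sub>C ordered_prod (\<lambda>i. gen_act g (Inl i)) xs c =
       (-1) ^ length xs *s ordered_prod (\<lambda>i. gen_act g (Inl i)) xs (gen_act g (Inr i) \<or>\<^sub>C c)" for xs c
    proof (induction xs)
      case (Cons y ys)
      have "gen_act g (Inr i) \<or>\<^sub>C ordered_prod (\<lambda>i. gen_act g (Inl i)) (y # ys) c =
         - (gen_act g (Inl y) \<or>\<^sub>C (gen_act g (Inr i) \<or>\<^sub>C ordered_prod (\<lambda>i. gen_act g (Inl i)) ys c))"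
        by (simp only: foldr.simps o_apply gen_act_swap_left[of g "Inr i"])
      then show ?case by (simp only: Cons) (simp add: vee_linear del: gen_act.simps)
    qed simp
    then show ?thesis
      by (simp add: Inr v vee_monomial cochain_act_monomial cochain_act_zero cochain_act_linear
          insr inv_number_bideg vimage_single inversions_single inversions_empty
          ordered_prod_scale ordered_prod_zero power_add mult_ac
          del: gen_act.simps)
  qed
qed (simp_all add: vee_linear cochain_act_linear)

lemma cochain_act_one: "cochain_act g one_C = one_C"
  using cochain_act_monomial[of g "{}"] by (simp add: one_C_monomial)

lemma cochain_act_gen: "cochain_act g (gen x) = gen_act g x" for g :: "'a::field_char_0 ^ 2 ^ 2"
  using cochain_act_gen_vee[of g x one_C] by (simp only: vee_one_right cochain_act_one)

lemma cochain_act_vee: "cochain_act g (a \<or>\<^sub>C b) = cochain_act g a \<or>\<^sub>C cochain_act g b"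
  for g :: "'a::field_char_0 ^ 2 ^ 2"
proof (induction a rule: cochain_gen_induct)
  case (gen x a)
  then show ?case by (simp only: vee_assoc cochain_act_gen_vee)
qed (simp_all add: vee_linear cochain_act_linear cochain_act_one vee_one_left)

lemma matrix_inv_SL2:
  fixes g :: "'a::field ^ 2 ^ 2"
  assumes "g \<in> SL2"
  shows "matrix_inv g = vector [vector [g$2$2, - g$1$2], vector [- g$2$1, g$1$1]]" (is "_ = ?h")
proof -
  have d: "g$1$1 * g$2$2 - g$1$2 * g$2$1 = 1" using assms by (simp add: SL2_def det_2)
  have gh: "g ** ?h = mat 1" and hg: "?h ** g = mat 1"
    using d by (simp_all add: vec_eq_iff forall_2 matrix_matrix_mult_def sum_2 mat_def algebra_simps)
  have "g ** matrix_inv g = mat 1"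
    unfolding matrix_inv_def using gh hg by (rule_tac someI2[of _ ?h]) auto
  then have "?h ** (g ** matrix_inv g) = ?h" by simp
  then show ?thesis by (simp add: matrix_mul_assoc hg)
qed

lemma gen_act_SL2:
  fixes g :: "'a::field_char_0 ^ 2 ^ 2"
  assumes "g \<in> SL2"
  shows "gen_act g (Inr I1) = g$1$1 *s Xd1 + g$2$1 *s Xdm1"
    "gen_act g (Inr Im1) = g$1$2 *s Xd1 + g$2$2 *s Xdm1"
    "gen_act g (Inr I0) = Hd0"
    "gen_act g (Inl I1) = g$2$2 *s Xum1 - g$1$2 *s Xu1"
    "gen_act g (Inl Im1) = g$1$1 *s Xu1 - g$2$1 *s Xum1"
    "gen_act g (Inl I0) = Hu0"
  by (simp_all add: of_heis_gen of_heis_dual_gen sum_hidx heis_act_def heis_dual_act_def pairing_def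
      matrix_inv_SL2[OF assms] axis_def)

text \<open>
  Both sides are derivations along the action, so equality on generators suffices. There it says that the
  Lie bracket is invariant, which uses \<open>det g = 1\<close>.
\<close>

lemma ce_d_cochain_act:
  fixes g :: "'a::field_char_0 ^ 2 ^ 2"
  assumes g: "g \<in> SL2"
  shows "ce_d (cochain_act g a) = cochain_act g (ce_d a)"
proof (induction a rule: cochain_gen_induct)
  case one
  show ?case by (simp add: cochain_act_one ce_d_gen cochain_act_zero)
next
  case (gen x a)
  have d: "g$1$1 * g$2$2 = 1 + g$1$2 * g$2$1" using g by (simp add: SL2_def det_2 algebra_simps)
  have "ce_d (gen_act g x) = cochain_act g (ce_d (gen x))"
    by (cases x; rename_tac i; case_tac i)
      (simp_all add: gen_act_SL2[OF g] ce_d_linear ce_d_gen cochain_act_vee cochain_act_gen cochain_act_zero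
        cochain_act_minus normal_order hidx_rank.simps vec_eq_iff algebra_simps d del: gen_act.simps)
  then show ?case
    using gen by (simp add: cochain_act_vee cochain_act_gen ce_d_vee grade_inv_gen grade_inv_gen_act vee_linear
        cochain_act_linear cochain_act_diff del: gen_act.simps)
qed (simp_all add: ce_d_linear cochain_act_linear)

lemma coh_act_class:
  fixes g :: "'a::field_char_0 ^ 2 ^ 2"
  assumes g: "g \<in> SL2" and a: "a \<in> cocycles"
  shows "coh_act g (coh_class a) = coh_class (cochain_act g a)"
  unfolding coh_act_def using a
proof (rule coh_lift_class)
  fix x assume x: "x \<in> cocycles" "a - x \<in> range ce_d"
  have c: "cochain_act g y \<in> cocycles" if "y \<in> cocycles" for y
    using that by (simp add: cocycles_def ce_d_cochain_act[OF g] cochain_act_zero)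
  have "cochain_act g x - cochain_act g a = cochain_act g (- (a - x))"
    by (simp add: cochain_act_diff)
  also have "\<dots> \<in> range ce_d"
    using ce_d_range_subspace(4)[OF x(2)] by (auto simp flip: ce_d_cochain_act[OF g])
  finally show "coh_class (cochain_act g x) = coh_class (cochain_act g a)"
    using x a by (simp add: coh_class_eq_iff c)
qed

section \<open>Equivariant lifts to cocycles\<close>

text \<open>
  The images of the coordinate vectors of \<open>V k\<close> arise from the highest weight vectors by the lowering operator
  \<open>F\<close>, which maps \<open>x\<^sub>1\<close> to \<open>x\<^sub>-\<^sub>1\<close>, \<open>x\<^sup>1\<close> to \<open>- x\<^sup>-\<^sup>1\<close> and acts on matrices by the commutator.
  For \<open>V 2\<close> it sends the raising element \<open>E\<close> to \<open>- H\<close> and \<open>H\<close> to \<open>2 F\<close>. The function is defined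
  on the whole direct sum of the three modules and reads off the coordinates of the relevant summand.
\<close>

primrec lift :: "summand \<Rightarrow> 'a::field irr \<Rightarrow> 'a cochain" where
  "lift H0_00 = (\<lambda>(c, x, A). c *s one_C)"
| "lift H0_11 = (\<lambda>(c, x, A). c *s ((Xu1 \<or>\<^sub>C Xdm1) + (Xum1 \<or>\<^sub>C Xd1) + 2 *s (Hu0 \<or>\<^sub>C Hd0)))"
| "lift H2_11 = (\<lambda>(c, x, A). A$1$2 *s (Xu1 \<or>\<^sub>C Xd1) + A$1$1 *s ((Xum1 \<or>\<^sub>C Xd1) - (Xu1 \<or>\<^sub>C Xdm1))
     + A$2$1 *s (Xum1 \<or>\<^sub>C Xdm1))"
| "lift H1_20 = (\<lambda>(c, x, A). x$1 *s (Xu1 \<or>\<^sub>C Hu0) - x$2 *s (Xum1 \<or>\<^sub>C Hu0))"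
| "lift H1_02 = (\<lambda>(c, x, A). x$1 *s (Xd1 \<or>\<^sub>C Hd0) + x$2 *s (Xdm1 \<or>\<^sub>C Hd0))"
| "lift H0_22 = (\<lambda>(c, x, A). c *s (Xum1 \<or>\<^sub>C (Xu1 \<or>\<^sub>C (Xd1 \<or>\<^sub>C Xdm1))))"
| "lift H2_22 = (\<lambda>(c, x, A). A$1$2 *s (Xu1 \<or>\<^sub>C (Hu0 \<or>\<^sub>C (Xd1 \<or>\<^sub>C Hd0)))
     + A$1$1 *s ((Xum1 \<or>\<^sub>C (Hu0 \<or>\<^sub>C (Xd1 \<or>\<^sub>C Hd0))) - (Xu1 \<or>\<^sub>C (Hu0 \<or>\<^sub>C (Xdm1 \<or>\<^sub>C Hd0))))
     + A$2$1 *s (Xum1 \<or>\<^sub>C (Hu0 \<or>\<^sub>C (Xdm1 \<or>\<^sub>C Hd0))))"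
| "lift H1_31 = (\<lambda>(c, x, A). x$1 *s (Xum1 \<or>\<^sub>C (Xu1 \<or>\<^sub>C (Hu0 \<or>\<^sub>C Xd1)))
     + x$2 *s (Xum1 \<or>\<^sub>C (Xu1 \<or>\<^sub>C (Hu0 \<or>\<^sub>C Xdm1))))"
| "lift H1_13 = (\<lambda>(c, x, A). x$1 *s (Xu1 \<or>\<^sub>C (Xd1 \<or>\<^sub>C (Xdm1 \<or>\<^sub>C Hd0)))
     - x$2 *s (Xum1 \<or>\<^sub>C (Xd1 \<or>\<^sub>C (Xdm1 \<or>\<^sub>C Hd0))))"
| "lift H0_33 = (\<lambda>(c, x, A). c *s (Xum1 \<or>\<^sub>C (Xu1 \<or>\<^sub>C (Hu0 \<or>\<^sub>C (Xd1 \<or>\<^sub>C (Xdm1 \<or>\<^sub>C Hd0))))))"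

lemma lift_linear: "lift s (v + w) = lift s v + lift s w" "lift s (irr_scale c v) = c *s lift s v"
  by (cases s; cases v; cases w; simp add: irr_scale_def vec_eq_iff algebra_simps)+

lemma lift_cocycle: "lift s v \<in> cocycles"
  by (cases s; cases v)
    (simp_all add: cocycles_def ce_d_linear ce_d_vee ce_d_gen grade_inv_gen normal_order, simp_all add: vec_eq_iff)

text \<open>
  Being fixed by the grade involution is used as a computable form of lying in the even part.
\<close>

lemma grade_inv_lift: "grade_inv (lift s v) = lift s v"
  by (cases s; cases v)
    (simp_all add: grade_inv_linear grade_inv_vee grade_inv_gen grade_inv_one vee_linear)

lemma lift_vbar: "lift s (vbar (hw s)) = hwv s"
  by (cases s) (simp_all add: vbar_def to_words)

lemma V_cases:
  assumes "v \<in> V k"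
  obtains (0) c where "k = 0" "v = (c, 0, 0)" | (1) x where "k = 1" "v = (0, x, 0)"
    | (2) A where "k = 2" "v = (0, 0, A)" "A $ 2 $ 2 = - (A $ 1 $ 1)"
  using assms by (auto simp: V_def trace_def sum_2 eq_neg_iff_add_eq_0 add.commute split: if_splits)

text \<open>
  The elements \<open>x\<^sup>-\<^sup>1 x\<^sup>1\<close> and \<open>x\<^sub>1 x\<^sub>-\<^sub>1\<close> are multiplied by \<open>det g = 1\<close>. Using this before expanding keeps
  the words in \<open>lift_equivariant\<close> at most quadratic in \<open>g\<close>.
\<close>

lemma gen_act_det:
  fixes g :: "'a::field_char_0 ^ 2 ^ 2"
  assumes g: "g \<in> SL2"
  shows "gen_act g (Inl I1) \<or>\<^sub>C (gen_act g (Inl Im1) \<or>\<^sub>C c) = Xum1 \<or>\<^sub>C (Xu1 \<or>\<^sub>C c)"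
    "gen_act g (Inr I1) \<or>\<^sub>C (gen_act g (Inr Im1) \<or>\<^sub>C c) = Xd1 \<or>\<^sub>C (Xdm1 \<or>\<^sub>C c)"
    "gen_act g (Inr I1) \<or>\<^sub>C gen_act g (Inr Im1) = Xd1 \<or>\<^sub>C Xdm1"
proof -
  have d: "g$1$1 * g$2$2 = 1 + g$1$2 * g$2$1" using g by (simp add: SL2_def det_2 algebra_simps)
  then have d': "g$1$1 * (g$2$2 * y) = y + g$1$2 * (g$2$1 * y)" for y
    by (simp add: distrib_right flip: mult.assoc)
  show "gen_act g (Inl I1) \<or>\<^sub>C (gen_act g (Inl Im1) \<or>\<^sub>C c) = Xum1 \<or>\<^sub>C (Xu1 \<or>\<^sub>C c)"
    "gen_act g (Inr I1) \<or>\<^sub>C (gen_act g (Inr Im1) \<or>\<^sub>C c) = Xd1 \<or>\<^sub>C (Xdm1 \<or>\<^sub>C c)"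
    "gen_act g (Inr I1) \<or>\<^sub>C gen_act g (Inr Im1) = Xd1 \<or>\<^sub>C Xdm1"
    by (simp_all add: gen_act_SL2[OF g] normal_order vec_eq_iff algebra_simps d d' del: gen_act.simps)
qed

lemma lift_equivariant:
  fixes g :: "'a::field_char_0 ^ 2 ^ 2"
  assumes g: "g \<in> SL2" and v: "v \<in> V (hw s)"
  shows "cochain_act g (lift s v) = lift s (irr_act g v)"
proof -
  have d: "g$1$1 * g$2$2 = 1 + g$1$2 * g$2$1" using g by (simp add: SL2_def det_2 algebra_simps)
  then have d': "g$1$1 * (g$2$2 * y) = y + g$1$2 * (g$2$1 * y)" for y
    by (simp add: distrib_right flip: mult.assoc)
  from v obtain c x A where v': "v = (c, x, A)" and tr: "hw s = 2 \<Longrightarrow> A $ 2 $ 2 = - (A $ 1 $ 1)"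
    by (cases rule: V_cases) auto
  have act: "cochain_act g (lift s v) = lift s (irr_act g v)" if "s \<noteq> H0_11"
    using that tr unfolding v'
    by (cases s)
      (simp_all add: irr_act_def cochain_act_linear cochain_act_diff cochain_act_vee cochain_act_gen cochain_act_one
        gen_act_det[OF g] del: gen_act.simps,
      simp_all add: gen_act_SL2[OF g] matrix_inv_SL2[OF g] matrix_matrix_mult_def matrix_vector_mult_def sum_2
        normal_order vec_eq_iff algebra_simps del: gen_act.simps)
  have "cochain_act g (lift H0_11 v) = lift H0_11 (irr_act g v)"
    unfolding v'
    by (simp add: irr_act_def cochain_act_linear cochain_act_vee cochain_act_gen gen_act_SL2[OF g] normal_order vec_eq_iff
       algebra_simps d d' del: gen_act.simps)
  with act show ?thesis by metis
qed

section \<open>The table on the level of cochains\<close>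

text \<open>
  The factors by which \<open>d (h\<^sup>0 \<or> x\<^sub>1 \<or> x\<^sub>-\<^sub>1)\<close>, that is
  \<open>x\<^sup>-\<^sup>1 x\<^sup>1 x\<^sub>1 x\<^sub>-\<^sub>1 - x\<^sup>1 h\<^sup>0 x\<^sub>-\<^sub>1 h\<^sub>0 - x\<^sup>-\<^sup>1 h\<^sup>0 x\<^sub>1 h\<^sub>0\<close>, occurs in the products. Each is read
  off from the coefficient of \<open>x\<^sup>1 h\<^sup>0 x\<^sub>-\<^sub>1 h\<^sub>0\<close> after subtracting the adjoint component, since the lift
  of \<open>V 0\<close> does not contain this word.
\<close>

fun table_correction :: "summand \<Rightarrow> summand \<Rightarrow> 'a::field irr \<Rightarrow> 'a irr \<Rightarrow> 'a" where
  "table_correction H0_11 H0_11 (c, x, A) (r, y, B) = 4 * c * r"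
| "table_correction H1_20 H1_02 (c, x, A) (r, y, B) = - (x$1 * y$2 - x$2 * y$1) / 2"
| "table_correction H1_02 H1_20 (c, x, A) (r, y, B) = (x$1 * y$2 - x$2 * y$1) / 2"
| "table_correction s t v w = 0"

lemma header_index_cases:
  assumes "i < length header"
  shows "i \<in> {0, 1, 2, 3, 4, 5, 6, 7, 8, 9}"
  using assms by (auto simp: header_def)

text \<open>
  Both sides are brought to normal order for all hundred pairs. The condition on the trace enters where
  \<open>A $ 2 $ 2\<close> appears in a matrix product, since the lifts do not use this entry.
\<close>

lemma lift_vee_lift:
  fixes v w :: "'a::field_char_0 irr"
  assumes i: "i < length header" and j: "j < length header"
    and v: "v \<in> V (hw (header ! i))" and w: "w \<in> V (hw (header ! j))"
  shows "lift (header ! i) v \<or>\<^sub>C lift (header ! j) w =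
    sum_list (map (\<lambda>(c, s). c *s lift s (m_map (hw (header ! i)) (hw (header ! j)) (hw s) v w)) (cup_table ! i ! j))
    + ce_d (table_correction (header ! i) (header ! j) v w *s (Hu0 \<or>\<^sub>C (Xd1 \<or>\<^sub>C Xdm1)))"
proof -
  obtain c x A where v': "v = (c, x, A)" and tv: "hw (header ! i) = 2 \<Longrightarrow> A $ 2 $ 2 = - (A $ 1 $ 1)"
    using v by (cases rule: V_cases) auto
  obtain r y B where w': "w = (r, y, B)" and tw: "hw (header ! j) = 2 \<Longrightarrow> B $ 2 $ 2 = - (B $ 1 $ 1)"
    using w by (cases rule: V_cases) auto
  note defs = header_def cup_table_def m_map_def irr_scale_def normal_order ce_d_linear ce_d_vee ce_d_gen grade_inv_gen grade_inv_vee
      trace_def sum_2 matrix_matrix_mult_def vector_matrix_mult_def transpose_def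
  show ?thesis
    using header_index_cases[OF i] header_index_cases[OF j] tv tw unfolding v' w'
    by (elim insertE emptyE; hypsubst; simp add: defs; simp add: vec_eq_iff field_simps)
qed

section \<open>The modules \<open>V k\<close> are generated by their highest weight vectors\<close>

lemma V_add: "v \<in> V k \<Longrightarrow> w \<in> V k \<Longrightarrow> v + w \<in> V k"
  by (auto simp: V_def trace_def sum_2 algebra_simps split: if_splits)

lemma V_scale: "v \<in> V k \<Longrightarrow> irr_scale c v \<in> V k"
  by (auto simp: V_def trace_def sum_2 irr_scale_def vec_eq_iff simp flip: distrib_left split: if_splits)

lemma V_act:
  assumes g: "g \<in> SL2" and v: "v \<in> V k"
  shows "irr_act g v \<in> V k"
proof -
  have d: "g$1$1 * g$2$2 - g$1$2 * g$2$1 = 1" using g by (simp add: SL2_def det_2)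
  have "matrix_inv g ** g = mat 1"
    using d by (simp add: matrix_inv_SL2[OF g] vec_eq_iff forall_2 matrix_matrix_mult_def sum_2 mat_def algebra_simps)
  then have "trace (g ** A ** matrix_inv g) = trace A" for A
    by (metis trace_mul_sym matrix_mul_assoc matrix_mul_lid)
  moreover have zero: "g ** 0 ** matrix_inv g = 0" "g *v 0 = 0"
    by (simp_all add: vec_eq_iff matrix_matrix_mult_def matrix_vector_mult_def)
  ultimately show ?thesis
    using v zero by (auto simp: V_def irr_act_def split: if_splits)
qed

lemma vbar_V: "vbar (hw s) \<in> V (hw s)"
  by (cases s) (simp_all add: vbar_def V_def trace_def sum_2)

lemma V_mem: "(c, 0, 0) \<in> V 0" "(0, x, 0) \<in> V 1" "(0, x, 0) \<in> V (Suc 0)" "A $ 1 $ 1 + A $ 2 $ 2 = 0 \<Longrightarrow> (0, 0, A) \<in> V 2"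
  by (simp_all add: V_def trace_def sum_2)

lemma V_zero: "k \<le> 2 \<Longrightarrow> 0 \<in> V k"
  by (auto simp: V_def trace_def sum_2 zero_prod_def)

text \<open>
  For triples without a chosen map the value of \<^const>\<open>m_map\<close> is \<open>0\<close>, which lies in every \<open>V k\<close> with \<open>k \<le> 2\<close>.
\<close>

lemma m_map_V:
  assumes "v \<in> V i" "w \<in> V j" "k \<le> 2"
  shows "m_map i j k v w \<in> V k"
proof -
  obtain c x A r y B where vw: "v = (c, x, A)" "w = (r, y, B)" by (cases v; cases w)
  have default: "m_map i j k v w = 0"
    if "\<not> (i = 0 \<and> j = k)" "\<not> (j = 0 \<and> i = k)" "(i, j, k) \<noteq> (1, 1, 0)" "(i, j, k) \<noteq> (1, 1, 2)"
      "(i, j, k) \<noteq> (2, 1, 1)" "(i, j, k) \<noteq> (1, 2, 1)" "(i, j, k) \<noteq> (2, 2, 0)" "(i, j, k) \<noteq> (2, 2, 2)"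
    unfolding m_map_def vw prod.case that(1-8)[THEN if_not_P] ..
  consider "i = 0 \<and> j = k" | "j = 0 \<and> i = k" | "(i, j, k) = (1, 1, 0)" | "(i, j, k) = (1, 1, 2)"
    | "(i, j, k) = (2, 1, 1)" | "(i, j, k) = (1, 2, 1)" | "(i, j, k) = (2, 2, 0)" | "(i, j, k) = (2, 2, 2)"
    | "m_map i j k v w = 0"
    using default by metis
  then show ?thesis
  proof cases
    case 1 then show ?thesis using V_scale[OF assms(2)] by (simp add: m_map_def vw)
  next
    case 2 then show ?thesis using V_scale[OF assms(1)] V_scale[OF assms(2)] by (auto simp: m_map_def vw)
  next
    case 9 then show ?thesis using V_zero[OF assms(3)] by simp
  qed (simp_all add: m_map_def vw V_mem sum_2 matrix_matrix_mult_def)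
qed

text \<open>
  The orbit of the highest weight vector spans \<open>V k\<close>. The Weyl element \<open>n\<close> maps the first basis vector of \<open>V 1\<close>
  to the second and \<open>E\<close> to \<open>- F\<close>; the unipotent element \<open>l\<close> maps \<open>E\<close> to \<open>E - H - F\<close>, which yields \<open>H\<close>.
\<close>

lemma V_induct [consumes 1, case_names vbar add scale act]:
  assumes v: "v \<in> V (hw s)"
    and vbar: "P (vbar (hw s))"
    and add: "\<And>v w. v \<in> V (hw s) \<Longrightarrow> w \<in> V (hw s) \<Longrightarrow> P v \<Longrightarrow> P w \<Longrightarrow> P (v + w)"
    and scale: "\<And>c v. v \<in> V (hw s) \<Longrightarrow> P v \<Longrightarrow> P (irr_scale c v)"
    and act: "\<And>g v. g \<in> SL2 \<Longrightarrow> v \<in> V (hw s) \<Longrightarrow> P v \<Longrightarrow> P (irr_act g v)"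
  shows "P (v :: 'a::field irr)"
proof -
  define Q where "Q v \<longleftrightarrow> v \<in> V (hw s) \<and> P v" for v
  have Q: "Q (vbar (hw s))" by (simp add: Q_def vbar_V vbar)
  have Q_add: "Q (v + w)" if "Q v" "Q w" for v w using that by (simp add: Q_def V_add add)
  have Q_scale: "Q (irr_scale c v)" if "Q v" for c v using that by (simp add: Q_def V_scale scale)
  have Q_act: "Q (irr_act g v)" if "g \<in> SL2" "Q v" for g v using that by (simp add: Q_def V_act act)
  define n :: "'a ^ 2 ^ 2" where "n = vector [vector [0, -1], vector [1, 0]]"
  define l :: "'a ^ 2 ^ 2" where "l = vector [vector [1, 0], vector [1, 1]]"
  have n: "n \<in> SL2" and l: "l \<in> SL2" by (simp_all add: SL2_def det_2 n_def l_def)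
  have "Q v" using v
  proof (cases rule: V_cases)
    case (0 c)
    then have "v = irr_scale c (vbar (hw s))" by (simp add: vbar_def irr_scale_def vec_eq_iff)
    then show ?thesis by (auto intro: Q Q_scale)
  next
    case (1 x)
    then have "v = irr_scale (x$1) (vbar (hw s)) + irr_scale (x$2) (irr_act n (vbar (hw s)))"
      by (simp add: vbar_def irr_scale_def irr_act_def n_def matrix_vector_mult_def sum_2 vec_eq_iff forall_2)
    then show ?thesis using n by (auto intro!: Q Q_scale Q_add Q_act)
  next
    case (2 A)
    \<comment> \<open>\<open>?e = E\<close>, and the last bracket is \<open>E - F - (E - H - F) = H\<close>\<close>
    let ?e = "vbar (hw s)"
    have "v = irr_scale (A$1$2) ?e + irr_scale (- (A$2$1)) (irr_act n ?e) +
      irr_scale (A$1$1) (?e + irr_act n ?e + irr_scale (- 1) (irr_act l ?e))"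
      using 2 by (simp add: vbar_def irr_scale_def irr_act_def matrix_inv_SL2[OF n] matrix_inv_SL2[OF l])
         (simp add: n_def l_def matrix_matrix_mult_def sum_2 vec_eq_iff forall_2)
    then show ?thesis using n l by (auto intro!: Q Q_scale Q_add Q_act)
  qed
  then show ?thesis by (simp add: Q_def)
qed

section \<open>The lifts are not exact\<close>

text \<open>
  In each summand of \<open>d\<close> a letter is deleted and two other letters are multiplied, so no monomial that occurs
  contains all six letters.
\<close>

lemma exact_top_component:
  assumes "y \<in> range ce_d"
  shows "y $ (UNIV, UNIV) = 0"
proof -
  have "((gen a \<or>\<^sub>C gen b) \<or>\<^sub>C contract x c) $ bideg_index UNIV = 0" if "x \<noteq> a" "x \<noteq> b" for a b x and c :: "'a cochain"
  proof (induction c rule: cochain_basis_induct)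
    case (monomial A)
    have "UNIV \<noteq> insert a (insert b (A - {x}))" "UNIV \<noteq> insert b (insert a (A - {x}))"
      using that by auto
    then show ?case
      by (simp add: vee_assoc contract_monomial vee_linear vee_monomial monomial_component del: vimage_UNIV)
  qed (simp_all add: contract_linear vee_linear)
  from this[of "Inr I1"] this[of "Inr Im1"] this[of "Inl I0"] show ?thesis
    using assms by (auto simp: ce_d_eq)
qed

lemma top_component:
  "(Xum1 \<or>\<^sub>C (Xu1 \<or>\<^sub>C (Hu0 \<or>\<^sub>C (Xd1 \<or>\<^sub>C (Xdm1 \<or>\<^sub>C Hd0))))) $ (UNIV, UNIV) \<noteq> (0 :: 'a::field)"
proof -
  have "x \<in> {Inl I1, Inl Im1, Inl I0, Inr I1, Inr Im1, Inr I0}" for x :: "hidx + hidx"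
    by (cases x; rename_tac i; case_tac i) auto
  then have "UNIV = {Inl I1, Inl Im1, Inl I0, Inr I1, Inr Im1, Inr I0}" by blast
  then have "monomial {Inl I1, Inl Im1, Inl I0, Inr I1, Inr Im1, Inr I0} $ (UNIV, UNIV) = (1 :: 'a)"
    using monomial_component[of UNIV UNIV, where 'a = 'a] by simp
  then show ?thesis by (simp add: vee_monomial vee_linear insert_commute)
qed

text \<open>
  The product with every lift of the complementary summand, the one in bidegree \<open>(3 - p, 3 - q)\<close> with the
  same highest weight, would be exact and would thus vanish in the top degree. The top coefficients of these
  products are, up to nonzero factors, the coordinates of \<open>v\<close>.
\<close>

lemma lift_exact:
  fixes v :: "'a::field_char_0 irr"
  assumes v: "v \<in> V (hw s)" and ex: "lift s v \<in> range ce_d"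
  shows "v = 0"
proof -
  have top: "(lift s v \<or>\<^sub>C lift t w) $ (UNIV, UNIV) = 0" for t w
    using exact_top_component exact_vee[OF ex lift_cocycle] by blast
  obtain c x A where v': "v = (c, x, A)" by (cases v)
  have vz: "(hw s = 0 \<longrightarrow> x = 0 \<and> A = 0) \<and> (hw s = 1 \<longrightarrow> c = 0 \<and> A = 0) \<and>
      (hw s = 2 \<longrightarrow> c = 0 \<and> x = 0 \<and> A$2$2 = - (A$1$1))"
    using v by (cases rule: V_cases) (simp_all add: v')
  note z = top[unfolded v']
  \<comment> \<open>the tests are the basis vectors of the three modules; the lift of a matrix uses its entries
      \<open>11\<close>, \<open>12\<close> and \<open>21\<close> only, so matrix units serve for \<open>V 2\<close>\<close>
  note scalar = z[of _ "(1, 0, 0)"]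
  note vector = z[of _ "(0, axis 1 1, 0)"] z[of _ "(0, axis 2 1, 0)"]
  note matrix = z[of _ "(0, 0, axis 1 (axis 1 1))"] z[of _ "(0, 0, axis 1 (axis 2 1))"] z[of _ "(0, 0, axis 2 (axis 1 1))"]
  note [simp] = normal_order axis_def vec_eq_iff forall_2 top_component zero_prod_def v'
  show ?thesis
  proof (cases s)
    case H0_00 then show ?thesis using vz scalar[of H0_33] by simp
  next
    case H0_11 then show ?thesis using vz scalar[of H0_22] by simp
  next
    case H2_11 then show ?thesis using vz matrix[of H2_22] by simp
  next
    case H1_20 then show ?thesis using vz vector[of H1_13] by simp
  next
    case H1_02 then show ?thesis using vz vector[of H1_31] by simp
  next
    case H0_22 then show ?thesis using vz scalar[of H0_11] by simp
  next
    case H2_22 then show ?thesis using vz matrix[of H2_11] by simp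
  next
    case H1_31 then show ?thesis using vz vector[of H1_02] by simp
  next
    case H1_13 then show ?thesis using vz vector[of H1_20] by simp
  next
    case H0_33 then show ?thesis using vz scalar[of H0_00] by simp
  qed
qed

section \<open>The irreducible submodules and their parametrizations\<close>

lemma lift_H_E:
  fixes v :: "'a::field_char_0 irr"
  shows "coh_class (lift s v) \<in> H_E"
proof -
  have "even (card S + card T)" if "lift s v $ (S, T) \<noteq> 0" for S T
  proof -
    have "(-1) ^ (card S + card T) * lift s v $ (S, T) = lift s v $ (S, T)"
      using arg_cong[OF grade_inv_lift[of s v], of "\<lambda>y. y $ (S, T)"] by (simp add: grade_inv_def)
    then show ?thesis using that by (cases "even (card S + card T)") auto
  qed
  then show ?thesis
    unfolding H_E_def by (intro quotientI) (simp add: lift_cocycle)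
qed

lemma lift_class_simps:
  "coh_add (coh_class (lift s v)) (coh_class (lift s w)) = coh_class (lift s (v + w))"
  "coh_scale c (coh_class (lift s v)) = coh_class (lift s (irr_scale c v))"
  by (simp_all add: coh_add_class coh_scale_class lift_cocycle lift_linear)

lemma coh_act_lift:
  fixes g :: "'a::field_char_0 ^ 2 ^ 2"
  assumes "g \<in> SL2" "v \<in> V (hw s)"
  shows "coh_act g (coh_class (lift s v)) = coh_class (lift s (irr_act g v))"
  using assms by (simp add: coh_act_class lift_cocycle lift_equivariant)

lemma hw_le: "hw s \<le> 2"
  by (cases s) auto

lemma lift_zero: "lift s 0 = 0"
  by (cases s) (simp_all add: zero_prod_def)

text \<open>
  The image of \<open>V k\<close> is a submodule containing the highest weight vector, and by \<open>V_induct\<close> it is contained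
  in every other one.
\<close>

lemma H_sub_eq: "H_sub s = (\<lambda>v. coh_class (lift s v :: 'a::field_char_0 cochain)) ` V (hw s)" (is "_ = ?W")
proof
  have mem: "coh_class (lift s v) \<in> ?W" if "v \<in> V (hw s)" for v
    using that by (rule imageI)
  have "is_submodule ?W"
    unfolding is_submodule_def
  proof (intro conjI ballI allI)
    show "?W \<subseteq> H_E" using lift_H_E by blast
    show "coh_class 0 \<in> ?W" using mem[OF V_zero[OF hw_le]] by (simp only: lift_zero)
    show "coh_add X Y \<in> ?W" if "X \<in> ?W" "Y \<in> ?W" for X Y
      using that by (elim imageE) (simp only: lift_class_simps mem V_add)
    show "coh_scale c X \<in> ?W" if "X \<in> ?W" for c X
      using that by (elim imageE) (simp only: lift_class_simps mem V_scale)
    show "coh_act g X \<in> ?W" if "g \<in> SL2" "X \<in> ?W" for g X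
      using that by (elim imageE) (simp only: coh_act_lift mem V_act)
  qed
  moreover have "coh_class (hwv s) \<in> ?W"
    using mem[OF vbar_V] by (simp only: lift_vbar)
  ultimately show "H_sub s \<subseteq> ?W"
    unfolding H_sub_def by (intro hull_minimal) auto
next
  show "?W \<subseteq> H_sub s"
  proof clarify
    fix v :: "'a irr" assume "v \<in> V (hw s)"
    then have "coh_class (lift s v) \<in> W" if W: "is_submodule W" "coh_class (hwv s) \<in> W" for W
    proof (induction rule: V_induct)
      case vbar then show ?case using W(2) by (simp add: lift_vbar)
    next
      case (add v w) then show ?case using W(1) unfolding is_submodule_def by (metis lift_class_simps(1))
    next
      case (scale c v) then show ?case using W(1) unfolding is_submodule_def by (metis lift_class_simps(2))
    next
      case (act g v) then show ?case using W(1) coh_act_lift[OF act(1,2)] unfolding is_submodule_def by metis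
    qed
    then show "coh_class (lift s v) \<in> H_sub s" by (simp add: H_sub_def hull_def)
  qed
qed

lemma inj_on_lift_class: "inj_on (\<lambda>v. coh_class (lift s v :: 'a::field_char_0 cochain)) (V (hw s))"
proof (rule inj_onI)
  fix v w :: "'a irr" assume vw: "v \<in> V (hw s)" "w \<in> V (hw s)" "coh_class (lift s v) = coh_class (lift s w)"
  have "v + irr_scale (- 1) w = 0"
  proof (rule lift_exact)
    show "v + irr_scale (- 1) w \<in> V (hw s)" using vw by (intro V_add V_scale)
    show "lift s (v + irr_scale (- 1) w) \<in> range ce_d"
      using vw(3) by (simp add: lift_linear coh_class_eq_iff lift_cocycle)
  qed
  then show "v = w"
    by (cases v; cases w) (simp add: irr_scale_def zero_prod_def vec_eq_iff)
qed

text \<open>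
  The class of the lift is an isomorphism with the required properties, and a second one would agree
  with it on the highest weight vector and therefore everywhere.
\<close>

lemma tau_eq:
  fixes v :: "'a::field_char_0 irr"
  assumes "v \<in> V (hw s)"
  shows "tau s v = coh_class (lift s v)"
proof -
  let ?f = "restrict (\<lambda>v. coh_class (lift s v :: 'a cochain)) (V (hw s))"
  have f: "is_tau s ?f"
    unfolding is_tau_def
  proof (intro conjI ballI allI)
    show "bij_betw ?f (V (hw s)) (H_sub s)"
      by (simp add: bij_betw_def H_sub_eq inj_on_restrict_eq inj_on_lift_class)
  qed (simp_all add: V_add V_scale V_act vbar_V lift_class_simps coh_act_lift lift_vbar)
  have "f = ?f" if h: "is_tau s f" for f
  proof (rule extensionalityI)
    show "f \<in> extensional (V (hw s))" "?f \<in> extensional (V (hw s))" using h by (simp_all add: is_tau_def)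
    fix v :: "'a irr" assume "v \<in> V (hw s)"
    moreover from this have "f v = coh_class (lift s v)"
    proof (induction rule: V_induct)
      case vbar
      then show ?case using h by (simp add: is_tau_def lift_vbar)
    next
      case (add v w)
      then have "f (v + w) = coh_add (f v) (f w)" using h by (simp add: is_tau_def)
      then show ?case by (simp only: add lift_class_simps)
    next
      case (scale c v)
      then have "f (irr_scale c v) = coh_scale c (f v)" using h by (simp add: is_tau_def)
      then show ?case by (simp only: scale lift_class_simps)
    next
      case (act g v)
      then have "f (irr_act g v) = coh_act g (f v)" using h by (simp add: is_tau_def)
      then show ?case by (simp only: act coh_act_lift)
    qed
    ultimately show "f v = ?f v" by simp
  qed
  then have "tau s = ?f" unfolding tau_def using f by (intro the_equality)
  then show ?thesis using assms by simp
qed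

theorem theorem3p1:
  fixes i j :: nat and v w :: "'a::field_char_0 irr"
  assumes "i < length header" and "j < length header"
    and "v \<in> V (hw (header ! i))" and "w \<in> V (hw (header ! j))"
  shows "cup (tau (header ! i) v) (tau (header ! j) w) =
    coh_sum_list
      (map (\<lambda>(c, s). coh_scale c (tau s (m_map (hw (header ! i)) (hw (header ! j)) (hw s) v w)))
        (cup_table ! i ! j))"
proof -
  let ?m = "\<lambda>s. m_map (hw (header ! i)) (hw (header ! j)) (hw s) v w"
  let ?entry = "\<lambda>(c, s). c *s lift s (?m s)"
  have m: "?m s \<in> V (hw s)" for s
    using assms(3,4) hw_le by (rule m_map_V)
  have sum_cocycle: "sum_list (map ?entry es) \<in> cocycles" for es
    by (induction es) (auto simp: cocycles_subspace lift_cocycle)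
  have sum: "coh_sum_list (map (\<lambda>(c, s). coh_scale c (tau s (?m s))) es) = coh_class (sum_list (map ?entry es))" for es
  proof (induction es)
    case (Cons e es)
    then show ?case
      using sum_cocycle[of es]
      by (cases e) (simp add: coh_sum_list_def tau_eq[OF m] coh_scale_class coh_add_class lift_cocycle cocycles_subspace)
  qed (simp add: coh_sum_list_def)
  have "cup (tau (header ! i) v) (tau (header ! j) w) = coh_class (lift (header ! i) v \<or>\<^sub>C lift (header ! j) w)"
    using assms by (simp add: tau_eq cup_class lift_cocycle)
  also have "\<dots> = coh_class (sum_list (map ?entry (cup_table ! i ! j)))"
    by (intro coh_class_eq_iff[THEN iffD2] cocycles_vee lift_cocycle sum_cocycle)
      (simp add: lift_vee_lift[OF assms])
  finally show ?thesis by (simp only: sum)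
qed

end
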